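(* For every $\alpha\in(0,1)$ and every graphon $W$, if the graphon $W_{\to\alpha}$ is finitely forcible, then $W$ is weakly isomorphic to the graphon identically equal to $0$, i.e., $W_{\to\alpha}$ is equal to zero up to a set of measure zero.
   Context: A graphon is a symmetric measurable function $W:[0,1]^2\to[0,1]$. A $W$-random graph of order $k$ is obtained by sampling $x_1,\dots,x_k\in[0,1]$ uniformly and independently and joining vertices $i$ and $j$ by an edge with probability $W(x_i,x_j)$, independently. For a graph $H$, $d(H,W)$ is the probability that a $W$-random graph of order $|H|$ is isomorphic to $H$. Graphons $W,W'$ are weakly isomorphic if $d(H,W)=d(H,W')$ for every graph $H$. A graphon $W$ is finitely forcible if there are graphs $H_1,\dots,H_k$ such that every graphon $W'$ with $d(H_i,W')=d(H_i,W)$ for all $i\in[k]$ is weakly isomorphic to $W$. For a sequence of non-negative reals $\vec a=(a_i)_{i\ge1}$ with $\sum a_i=1$ and a graphon $W$, define $W_{\to\vec a}$ as follows: for $x,y\in[0,1)$ let $j_x,j_y$ be the integers with $\sum_{i<j_x}a_i\le x<\sum_{i\le j_x}a_i$ and $\sum_{i<j_y}a_i\le y<\sum_{i\le j_y}a_i$; if $j_x\ne j_y$ then $W_{\to\vec a}(x,y)=0$, and if $j_x=j_y=j$ then $W_{\to\vec a}(x,y)=W\big((x-\sum_{i<j}a_i)/a_j,(y-\sum_{i<j}a_i)/a_j\big)$ (values on the measure-zero remaining set are set to $0$). $W_{\to\alpha}$ denotes $W_{\to\vec a}$ with $a_i=(1-\alpha)\alpha^{i-1}$. *)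

theory Defs
  imports "HOL-Probability.Probability"
begin

text \<open>Finite simple graphs are pairs of a vertex set and a set of two-element edges. Taking
  vertices in \<^typ>\<open>nat\<close> loses nothing, as all notions below are invariant under isomorphism.\<close>

type_synonym sgraph = "nat set \<times> nat set set"

definition simple_graph :: "sgraph \<Rightarrow> bool" where
  "simple_graph G \<longleftrightarrow> finite (fst G) \<and> snd G \<subseteq> {e. e \<subseteq> fst G \<and> card e = 2}"

definition graph_iso :: "sgraph \<Rightarrow> sgraph \<Rightarrow> bool" where
  "graph_iso G H \<longleftrightarrow> (\<exists>f. bij_betw f (fst G) (fst H) \<and>
     (\<forall>u\<in>fst G. \<forall>v\<in>fst G. {u, v} \<in> snd G \<longleftrightarrow> {f u, f v} \<in> snd H))"

text \<open>Only the values on the unit square matter; measurability is Lebesgue measurability.\<close>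

definition graphon :: "(real \<Rightarrow> real \<Rightarrow> real) \<Rightarrow> bool" where
  "graphon W \<longleftrightarrow>
     (\<lambda>(x, y). W x y) \<in> borel_measurable (lebesgue_on ({0..1} \<times> {0..1})) \<and>
     (\<forall>x\<in>{0..1}. \<forall>y\<in>{0..1}. W x y \<in> {0..1} \<and> W x y = W y x)"

text \<open>The law of the \<open>W\<close>-random graph on \<open>{..<k}\<close> conditioned on the sampled points
  \<open>x 0, \<dots>, x (k - 1)\<close>: one independent Bernoulli variable for each pair \<open>i < j\<close>.\<close>

definition random_graph_given ::
    "(real \<Rightarrow> real \<Rightarrow> real) \<Rightarrow> nat \<Rightarrow> (nat \<Rightarrow> real) \<Rightarrow> sgraph pmf" where
  "random_graph_given W k x =
     map_pmf (\<lambda>b. ({..<k}, {{i, j} |i j. i < j \<and> j < k \<and> b (i, j)}))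
       (Pi_pmf {(i, j). i < j \<and> j < k} False (\<lambda>(i, j). bernoulli_pmf (W (x i) (x j))))"

definition sample_points :: "nat \<Rightarrow> (nat \<Rightarrow> real) measure" where
  "sample_points k = PiM {..<k} (\<lambda>_. restrict_space lborel {0..1})"

text \<open>The probability that the \<open>W\<close>-random graph of order \<open>|H|\<close> is isomorphic to \<open>H\<close>, obtained by
  averaging the conditional probability over the sampled points. The completion is needed because
  the integrand is in general only Lebesgue measurable, while \<^const>\<open>PiM\<close> carries the
  Borel sets.\<close>

definition graph_density :: "sgraph \<Rightarrow> (real \<Rightarrow> real \<Rightarrow> real) \<Rightarrow> real" where
  "graph_density H W =
     (LINT x | completion (sample_points (card (fst H))).
        measure_pmf.prob (random_graph_given W (card (fst H)) x) {G. graph_iso G H})"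

definition weakly_isomorphic ::
    "(real \<Rightarrow> real \<Rightarrow> real) \<Rightarrow> (real \<Rightarrow> real \<Rightarrow> real) \<Rightarrow> bool" where
  "weakly_isomorphic W W' \<longleftrightarrow>
     (\<forall>H. simple_graph H \<longrightarrow> graph_density H W = graph_density H W')"

definition finitely_forcible :: "(real \<Rightarrow> real \<Rightarrow> real) \<Rightarrow> bool" where
  "finitely_forcible W \<longleftrightarrow>
     (\<exists>\<H>. finite \<H> \<and> (\<forall>H\<in>\<H>. simple_graph H) \<and>
       (\<forall>W'. graphon W' \<and> (\<forall>H\<in>\<H>. graph_density H W' = graph_density H W) \<longrightarrow>
          weakly_isomorphic W' W))"

text \<open>Sequences are indexed from 0, so \<open>a i\<close> stands for the \<open>(i + 1)\<close>-st term. If \<open>a\<close> is non-negative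
  with sum 1, the index below exists and is unique for every \<open>x \<in> [0, 1)\<close>.\<close>

definition part_index :: "(nat \<Rightarrow> real) \<Rightarrow> real \<Rightarrow> nat" where
  "part_index a x = (THE j. (\<Sum>i<j. a i) \<le> x \<and> x < (\<Sum>i\<le>j. a i))"

definition graphon_to_seq ::
    "(nat \<Rightarrow> real) \<Rightarrow> (real \<Rightarrow> real \<Rightarrow> real) \<Rightarrow> real \<Rightarrow> real \<Rightarrow> real" where
  "graphon_to_seq a W x y =
     (if x \<in> {0..<1} \<and> y \<in> {0..<1} \<and> part_index a x = part_index a y
      then let j = part_index a x; s = (\<Sum>i<j. a i) in W ((x - s) / a j) ((y - s) / a j)
      else 0)"

definition graphon_to :: "real \<Rightarrow> (real \<Rightarrow> real \<Rightarrow> real) \<Rightarrow> real \<Rightarrow> real \<Rightarrow> real" where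
  "graphon_to \<alpha> W = graphon_to_seq (\<lambda>i. (1 - \<alpha>) * \<alpha> ^ i) W"

end

theory Submission
  imports Defs
begin

text \<open>The density of \<open>H\<close> in \<open>W\<^bsub>\<rightarrow>a\<^esub>\<close> is a linear combination of homomorphism densities \<open>t F\<close>, and
  \<open>t F\<close> of \<open>W\<^bsub>\<rightarrow>a\<^esub>\<close> is \<open>t F\<close> of \<open>W\<close> times the product, over the components \<open>C\<close> of \<open>F\<close>, of the power sums
  \<open>\<Sum>i. a i ^ |C|\<close>. Hence the densities of all graphs with fewer than \<open>n\<close> vertices depend only on the
  first \<open>n - 1\<close> power sums of \<open>a\<close>. Replacing the first \<open>n\<close> terms of \<open>a\<close>, viewed as the roots of a monic
  polynomial, by the roots of that polynomial with a slightly shifted constant coefficient keeps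
  these power sums and changes the \<open>n\<close>-th one. So if finitely many densities force \<open>W\<^bsub>\<rightarrow>a\<^esub>\<close>, then every
  connected graph on \<open>n\<close> vertices has density \<open>0\<close> in \<open>W\<close>. Summing over the supergraphs of a star, the
  homomorphism density of the star, which is the \<open>(n - 1)\<close>-st moment of the degree function of \<open>W\<close>,
  vanishes, and therefore \<open>W = 0\<close> almost everywhere.\<close>

section \<open>Sequences with equal power sums\<close>

definition root_poly :: "nat \<Rightarrow> (nat \<Rightarrow> real) \<Rightarrow> real poly" where
  "root_poly n b = (\<Prod>i<n. [:- b i, 1:])"

lemma degree_root_poly: "degree (root_poly n b) = n"
  unfolding root_poly_def by (subst degree_prod_eq_sum_degree) auto

lemma coeff_root_poly_n: "coeff (root_poly n b) n = 1"
proof -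
  have "lead_coeff (root_poly n b) = 1"
    unfolding root_poly_def by (simp add: lead_coeff_prod)
  then show ?thesis by (simp add: degree_root_poly)
qed

lemma poly_root_poly: "poly (root_poly n b) t = (\<Prod>i<n. t - b i)"
  unfolding root_poly_def by (simp add: poly_prod)

text \<open>The \<open>e r\<close> are the signed elementary symmetric polynomials. Horner division
  by the factor of \<open>b i\<close> yields the coefficients of the cofactor \<open>q i\<close>;
  the \<open>q i\<close> add up to the derivative of \<open>root_poly n b\<close>, whose
  coefficients are multiples of the \<open>e l\<close>.\<close>

lemma newton_identity:
  fixes b :: "nat \<Rightarrow> real" and n :: nat
  defines "e \<equiv> \<lambda>r. coeff (root_poly n b) (n - r)"
  assumes "l < n"
  shows "(\<Sum>r\<le>l. e r * (\<Sum>i<n. b i ^ (l - r))) = real (n - l) * e l"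
proof -
  define q where "q = (\<lambda>i. \<Prod>j\<in>{..<n}-{i}. [:- b j, 1:])"
  have pq: "root_poly n b = [:- b i, 1:] * q i" if "i < n" for i
    unfolding root_poly_def q_def using that by (simp add: prod.remove)
  have dq: "degree (q i) = n - 1" if "i < n" for i
    unfolding q_def using that by (subst degree_prod_eq_sum_degree) auto
  have d: "coeff (q i) (n - 1 - l) = (\<Sum>r\<le>l. e r * b i ^ (l - r))" if "i < n" "l < n" for i l
    using that(2)
  proof (induction l)
    case 0
    have "coeff (root_poly n b) (Suc (n - 1)) = coeff (q i) (n - 1)"
      by (subst pq[OF that(1)]) (use dq[OF that(1)] in \<open>simp add: coeff_eq_0\<close>)
    then show ?case using that by (simp add: e_def)
  next
    case (Suc l)
    \<comment> \<open>With \<open>n = m + l + 2\<close> the indices \<open>n - 1 - Suc l\<close>,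
      \<open>n - 1 - l\<close> and \<open>n - Suc l\<close> become \<open>m\<close>,
      \<open>Suc m\<close> and \<open>Suc m\<close>, free of truncated subtraction.\<close>
    define m where "m = n - (l + 2)"
    have m: "n = m + l + 2" using Suc.prems by (simp add: m_def)
    have "coeff (root_poly n b) (Suc m) = coeff (q i) m - b i * coeff (q i) (Suc m)"
      by (subst pq[OF that(1)]) simp
    then have "coeff (q i) (n - 1 - Suc l) = e (Suc l) + b i * coeff (q i) (n - 1 - l)"
      by (simp add: e_def m)
    also have "\<dots> = e (Suc l) + b i * (\<Sum>r\<le>l. e r * b i ^ (l - r))"
      using Suc by simp
    also have "\<dots> = (\<Sum>r\<le>Suc l. e r * b i ^ (Suc l - r))"
      by (simp add: sum_distrib_left Suc_diff_le mult_ac)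
    finally show ?case .
  qed
  have "pderiv (root_poly n b) = (\<Sum>i<n. q i)"
    unfolding root_poly_def q_def by (simp add: pderiv_prod pderiv_pCons)
  then have "coeff (pderiv (root_poly n b)) (n - 1 - l) = (\<Sum>i<n. coeff (q i) (n - 1 - l))"
    by (simp add: coeff_sum)
  also have "\<dots> = (\<Sum>i<n. \<Sum>r\<le>l. e r * b i ^ (l - r))"
    using d assms by simp
  also have "\<dots> = (\<Sum>r\<le>l. e r * (\<Sum>i<n. b i ^ (l - r)))"
    by (subst sum.swap) (simp add: sum_distrib_left)
  finally show ?thesis
    using assms by (simp add: coeff_pderiv e_def Suc_diff_Suc)
qed

text \<open>Newton's identities express the power sums of exponents below \<open>n\<close> by the
  coefficients other than the constant one, which the shift leaves alone. The constant coefficient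
  enters the \<open>n\<close>-th power sum with the factor \<open>- n\<close>.\<close>

lemma power_sums_of_constant_shift:
  fixes a b :: "nat \<Rightarrow> real"
  assumes shift: "root_poly n b = root_poly n a + [:c:]" and "0 < n"
  shows "m < n \<Longrightarrow> (\<Sum>i<n. b i ^ m) = (\<Sum>i<n. a i ^ m)"
    and "(\<Sum>i<n. b i ^ n) = (\<Sum>i<n. a i ^ n) - real n * c"
proof -
  define e where "e = (\<lambda>b r. coeff (root_poly n b) (n - r))"
  have e: "e b r = e a r" if "r < n" for r
    using that by (simp add: e_def shift coeff_pCons split: nat.splits)
  have e0: "e b 0 = 1" for b by (simp add: e_def coeff_root_poly_n)
  have en: "e b n = e a n + c"
    by (simp add: e_def shift)
  show eq: "(\<Sum>i<n. b i ^ m) = (\<Sum>i<n. a i ^ m)" if "m < n" for m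
    using that
  proof (induction m rule: less_induct)
    case (less m)
    have split: "(\<Sum>r\<le>m. e b r * (\<Sum>i<n. b i ^ (m - r)))
        = (\<Sum>i<n. b i ^ m) + (\<Sum>r\<in>{1..m}. e b r * (\<Sum>i<n. b i ^ (m - r)))" for b
    proof -
      have "{..m} = insert 0 {1..m}" by auto
      then show ?thesis by (simp add: e0)
    qed
    have "(\<Sum>r\<in>{1..m}. e b r * (\<Sum>i<n. b i ^ (m - r)))
        = (\<Sum>r\<in>{1..m}. e a r * (\<Sum>i<n. a i ^ (m - r)))"
    proof (intro sum.cong refl)
      fix r assume r: "r \<in> {1..m}"
      then have "(\<Sum>i<n. b i ^ (m - r)) = (\<Sum>i<n. a i ^ (m - r))"
        using less.prems by (intro less.IH) auto
      then show "e b r * (\<Sum>i<n. b i ^ (m - r)) = e a r * (\<Sum>i<n. a i ^ (m - r))"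
        using e[of r] r less.prems by simp
    qed
    then show ?case
      using newton_identity[OF less.prems, of b] newton_identity[OF less.prems, of a]
        split[of a] split[of b] e[OF less.prems]
      unfolding e_def by simp
  qed
  \<comment> \<open>Exponent \<open>n\<close> lies outside the range of
    \<open>newton_identity\<close>; here the relation comes from evaluating the polynomial at its
    own roots and summing over them.\<close>
  have z: "(\<Sum>i<n. b i ^ n) + (\<Sum>r=1..n. e b r * (\<Sum>i<n. b i ^ (n - r))) = 0" for b
  proof -
    have "(\<Sum>r\<le>n. e b r * b i ^ (n - r)) = 0" if "i < n" for i
    proof -
      have "poly (root_poly n b) (b i) = 0"
        using that by (auto simp: poly_root_poly)
      then have "(\<Sum>r\<le>n. coeff (root_poly n b) r * b i ^ r) = 0"
        by (simp add: poly_altdef degree_root_poly)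
      also have "(\<Sum>r\<le>n. coeff (root_poly n b) r * b i ^ r)
          = (\<Sum>r\<le>n. e b r * b i ^ (n - r))"
        unfolding e_def by (rule sum.reindex_bij_witness[of _ "\<lambda>r. n - r" "\<lambda>r. n - r"]) auto
      finally show ?thesis .
    qed
    then have "(\<Sum>i<n. \<Sum>r\<le>n. e b r * b i ^ (n - r)) = 0" by simp
    then have "(\<Sum>r\<le>n. e b r * (\<Sum>i<n. b i ^ (n - r))) = 0"
      by (subst (asm) sum.swap) (simp add: sum_distrib_left)
    moreover have "{..n} = insert 0 {1..n}" by auto
    ultimately show ?thesis by (simp add: e0)
  qed
  have "(\<Sum>r=1..n. e b r * (\<Sum>i<n. b i ^ (n - r)))
      = (\<Sum>r=1..n. e a r * (\<Sum>i<n. a i ^ (n - r))) + real n * c"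
  proof -
    \<comment> \<open>Only the term \<open>r = n\<close> sees the shift; its power sum has exponent
      0 and hence the value \<open>n\<close>.\<close>
    have i: "{1..n} = insert n {1..<n}" using \<open>0 < n\<close> by auto
    have "(\<Sum>r\<in>{1..<n}. e b r * (\<Sum>i<n. b i ^ (n - r)))
        = (\<Sum>r\<in>{1..<n}. e a r * (\<Sum>i<n. a i ^ (n - r)))"
    proof (intro sum.cong refl)
      fix r assume r: "r \<in> {1..<n}"
      then have "(\<Sum>i<n. b i ^ (n - r)) = (\<Sum>i<n. a i ^ (n - r))"
        by (intro eq) auto
      then show "e b r * (\<Sum>i<n. b i ^ (n - r)) = e a r * (\<Sum>i<n. a i ^ (n - r))"
        using e[of r] r by simp
    qed
    then show ?thesis unfolding i by (simp add: en algebra_simps)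
  qed
  then show "(\<Sum>i<n. b i ^ n) = (\<Sum>i<n. a i ^ n) - real n * c"
    using z[of a] z[of b] by simp
qed

text \<open>Simple real roots persist under a small change of the constant coefficient: the
  intermediate value theorem gives a root of the shifted polynomial near each \<open>a i\<close>,
  and a monic polynomial of degree \<open>n\<close> is determined by \<open>n\<close> distinct
  roots.\<close>

lemma ex_constant_shift_roots:
  fixes a :: "nat \<Rightarrow> real"
  assumes "n \<noteq> 0" and pos: "\<And>i. i < n \<Longrightarrow> 0 < a i" and inj: "inj_on a {..<n}"
  obtains b c where "c \<noteq> 0" "\<forall>i<n. 0 < b i" "root_poly n b = root_poly n a + [:c:]"
proof -
  \<comment> \<open>The values and gaps whose minimum limits the radius \<open>r\<close>: with a
    third of it, the intervals of radius \<open>r\<close> around the \<open>a i\<close> are disjoint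
    and contain only positive numbers.\<close>
  define D where "D = insert 1 (a ` {..<n} \<union> (\<lambda>(i, j). \<bar>a i - a j\<bar>) ` {(i, j). i < n \<and> j < n \<and> i \<noteq> j})"
  have "finite {(i, j). i < n \<and> j < n \<and> i \<noteq> j}"
    by (rule finite_subset[of _ "{..<n} \<times> {..<n}"]) auto
  then have fD: "finite D" by (simp add: D_def)
  have posD: "\<forall>x\<in>D. 0 < x"
    using pos inj by (auto simp: D_def inj_on_def)
  define r where "r = Min D / 3"
  have r: "0 < r" using posD fD by (auto simp: r_def D_def)
  have rD: "3 * r \<le> x" if "x \<in> D" for x using that fD by (simp add: r_def)
  have ra: "r < a i" if "i < n" for i using rD[of "a i"] that r by (auto simp: D_def)
  have rsep: "3 * r \<le> \<bar>a i - a j\<bar>" if "i < n" "j < n" "i \<noteq> j" for i j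
    using that by (intro rD) (force simp: D_def)
  define p where "p = root_poly n a"
  \<comment> \<open>In the product below only the factor \<open>j = i\<close> is negative, so \<open>p\<close> changes sign around each root,
    and a shift smaller than all the values at \<open>a i \<plusminus> r\<close> preserves these sign changes.\<close>
  have sgn: "poly p (a i - r) * poly p (a i + r) < 0" if "i < n" for i
  proof -
    have "poly p (a i - r) * poly p (a i + r) = (\<Prod>j<n. (a i - a j)\<^sup>2 - r\<^sup>2)"
      unfolding p_def poly_root_poly prod.distrib[symmetric]
      by (intro prod.cong) (auto simp: power2_eq_square algebra_simps)
    also have "\<dots> = ((a i - a i)\<^sup>2 - r\<^sup>2) * (\<Prod>j\<in>{..<n}-{i}. (a i - a j)\<^sup>2 - r\<^sup>2)"
      using that by (simp add: prod.remove)
    also have "\<dots> < 0"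
    proof (rule mult_neg_pos)
      show "(\<Prod>j\<in>{..<n}-{i}. (a i - a j)\<^sup>2 - r\<^sup>2) > 0"
      proof (rule prod_pos)
        fix j assume "j \<in> {..<n}-{i}"
        then have "r < \<bar>a i - a j\<bar>" using rsep[of i j] that r by auto
        then have "r\<^sup>2 < \<bar>a i - a j\<bar>\<^sup>2" using r by (intro power_strict_mono) auto
        then show "0 < (a i - a j)\<^sup>2 - r\<^sup>2" by simp
      qed
    qed (use r in simp)
    finally show ?thesis .
  qed
  define C where "C = insert 1 ((\<lambda>i. min \<bar>poly p (a i - r)\<bar> \<bar>poly p (a i + r)\<bar>) ` {..<n})"
  define c where "c = Min C / 2"
  have fC: "finite C" by (simp add: C_def)
  have "\<forall>x\<in>C. 0 < x"
  proof -
    have "poly p (a i - r) \<noteq> 0 \<and> poly p (a i + r) \<noteq> 0" if "i < n" for i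
      using sgn[OF that] by (auto simp: mult_less_0_iff)
    then show ?thesis by (auto simp: C_def)
  qed
  then have c0: "0 < c" using fC by (auto simp: c_def C_def)
  have cC: "2 * c \<le> x" if "x \<in> C" for x using that fC by (simp add: c_def)
  have c1: "c < \<bar>poly p (a i - r)\<bar>" "c < \<bar>poly p (a i + r)\<bar>" if "i < n" for i
    using cC[of "min \<bar>poly p (a i - r)\<bar> \<bar>poly p (a i + r)\<bar>"] that c0 by (auto simp: C_def)
  have "\<exists>x. a i - r < x \<and> x < a i + r \<and> poly (p + [:c:]) x = 0" if "i < n" for i
  proof (rule poly_IVT)
    show "poly (p + [:c:]) (a i - r) * poly (p + [:c:]) (a i + r) < 0"
      using sgn[OF that] c1[OF that] c0 by (auto simp: mult_less_0_iff)
  qed (use r in simp)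
  then obtain b where b: "\<And>i. i < n \<Longrightarrow> a i - r < b i \<and> b i < a i + r \<and> poly (p + [:c:]) (b i) = 0"
    by metis
  have injb: "inj_on b {..<n}"
  proof (rule inj_onI, rule ccontr)
    fix i j assume "i \<in> {..<n}" "j \<in> {..<n}" "b i = b j" "i \<noteq> j"
    then show False using rsep[of i j] b[of i] b[of j] r by auto
  qed
  have "root_poly n b = p + [:c:]"
  proof (rule ccontr)
    define d where "d = root_poly n b - (p + [:c:])"
    assume "root_poly n b \<noteq> p + [:c:]"
    then have d0: "d \<noteq> 0" by (simp add: d_def)
    \<comment> \<open>Both polynomials are monic of degree \<open>n\<close>, as the shift reaches
      only coefficient 0 and \<open>n\<close> is not 0. Their difference thus has degree below
      \<open>n\<close> but vanishes at the \<open>n\<close> distinct points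
      \<open>b i\<close>.\<close>
    have "coeff d m = 0" if "n \<le> m" for m
      using that \<open>n \<noteq> 0\<close> coeff_root_poly_n[of n b] coeff_root_poly_n[of n a]
      by (cases "m = n") (auto simp: d_def p_def coeff_eq_0 degree_root_poly coeff_pCons split: nat.splits)
    then have deg: "degree d < n"
      by (metis d0 leading_coeff_0_iff linorder_not_le)
    have "b ` {..<n} \<subseteq> {x. poly d x = 0}"
      using b by (auto simp: d_def poly_root_poly)
    then have "card (b ` {..<n}) \<le> card {x. poly d x = 0}"
      using d0 by (intro card_mono) (auto simp: poly_roots_finite)
    also have "\<dots> \<le> degree d" using d0 by (rule card_poly_roots_bound)
    finally show False using deg injb by (simp add: card_image)
  qed
  moreover have "0 < b i" if "i < n" for i
    using b[OF that] ra[OF that] by simp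
  ultimately show thesis using c0 by (intro that[of c b]) (auto simp: p_def)
qed

section \<open>Sampling from the unit interval\<close>

definition unit_lborel :: "real measure" where
  "unit_lborel = restrict_space lborel {0..1}"

lemma space_unit_lborel [simp]: "space unit_lborel = {0..1}"
  by (simp add: unit_lborel_def space_restrict_space)

lemma emeasure_unit_lborel:
  "A \<in> sets unit_lborel \<Longrightarrow> emeasure unit_lborel A = emeasure lborel A"
  by (auto simp: unit_lborel_def emeasure_restrict_space sets_restrict_space)

interpretation unit_lborel: prob_space unit_lborel
proof
  show "emeasure unit_lborel (space unit_lborel) = 1"
    by (subst emeasure_unit_lborel[OF sets.top]) simp
qed

interpretation unit_product: product_prob_space "\<lambda>_. unit_lborel" I for I :: "'i set"
  by unfold_locales

lemma measurable_unit_lborel_id [measurable]: "(\<lambda>x. x) \<in> unit_lborel \<rightarrow>\<^sub>M borel"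
  by (simp add: unit_lborel_def measurable_restrict_space1)

lemma sample_points_eq: "sample_points k = PiM {..<k} (\<lambda>_. unit_lborel)"
  by (simp add: sample_points_def unit_lborel_def)

lemma sets_Collect_nat_eq:
  fixes f g :: "'a \<Rightarrow> nat"
  assumes [measurable]: "f \<in> M \<rightarrow>\<^sub>M count_space UNIV" "g \<in> M \<rightarrow>\<^sub>M count_space UNIV"
  shows "{x \<in> space M. f x = g x} \<in> sets M"
proof -
  have "{x \<in> space M. f x = g x} = {x \<in> space M. \<exists>j. f x = j \<and> g x = j}" by auto
  also have "\<dots> \<in> sets M" by measurable
  finally show ?thesis .
qed

text \<open>The preimages of a set under \<open>f\<close> and \<open>g\<close> differ only within a
  null set, and the completion measures every subset of a null set.\<close>

lemma borel_measurable_completion_AE: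
  fixes f g :: "'a \<Rightarrow> real"
  assumes eq: "AE x in M. g x = f x" and f: "f \<in> borel_measurable M"
  shows "g \<in> borel_measurable (completion M)"
proof (rule measurableI)
  fix A :: "real set" assume A: "A \<in> sets borel"
  have "Measurable.pred (completion M) (\<lambda>x. (g x \<in> A) \<noteq> (f x \<in> A))"
    using eq by (intro sets_completion_AE) (auto elim: eventually_mono)
  moreover have "Measurable.pred (completion M) (\<lambda>x. f x \<in> A)"
    using measurable_completion[OF f] A by measurable
  ultimately have "Measurable.pred (completion M) (\<lambda>x. ((g x \<in> A) \<noteq> (f x \<in> A)) \<noteq> (f x \<in> A))"
    by measurable
  also have "(\<lambda>x. ((g x \<in> A) \<noteq> (f x \<in> A)) \<noteq> (f x \<in> A)) = (\<lambda>x. g x \<in> A)" by auto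
  finally show "g -` A \<inter> space (completion M) \<in> sets (completion M)"
    by (simp add: pred_def vimage_def Int_def conj_commute)
qed simp

text \<open>The preimage of a rectangle is a box whose other factors are the whole space and
  contribute 1. Hence a null set of the square is hit by two given sample points with probability
  0.\<close>

lemma distr_PiM_pair:
  fixes M :: "'a measure" and I :: "'i set"
  assumes M: "prob_space M" and fin: "finite I" and i: "i \<in> I" and j: "j \<in> I" and "i \<noteq> j"
  shows "distr (PiM I (\<lambda>_. M)) (M \<Otimes>\<^sub>M M) (\<lambda>x. (x i, x j)) = M \<Otimes>\<^sub>M M"
proof (rule pair_measure_eqI[symmetric])
  interpret M: prob_space M by fact
  interpret product_prob_space "\<lambda>_. M" I by unfold_locales
  show "sigma_finite_measure M" "sigma_finite_measure M" by unfold_locales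
  show "sets (M \<Otimes>\<^sub>M M) = sets (distr (PiM I (\<lambda>_. M)) (M \<Otimes>\<^sub>M M) (\<lambda>x. (x i, x j)))" by simp
  fix A B assume A: "A \<in> sets M" and B: "B \<in> sets M"
  have [measurable]: "(\<lambda>x. (x i, x j)) \<in> PiM I (\<lambda>_. M) \<rightarrow>\<^sub>M M \<Otimes>\<^sub>M M"
    using i j by measurable
  define C where "C = (\<lambda>m. if m = i then A else if m = j then B else space M)"
  have "(\<lambda>x. (x i, x j)) -` (A \<times> B) \<inter> space (PiM I (\<lambda>_. M)) = PiE I C"
    using i j \<open>i \<noteq> j\<close> sets.sets_into_space[OF A] sets.sets_into_space[OF B]
    by (auto simp: space_PiM C_def PiE_iff split: if_splits) (metis subsetD)
  then have "emeasure (distr (PiM I (\<lambda>_. M)) (M \<Otimes>\<^sub>M M) (\<lambda>x. (x i, x j))) (A \<times> B)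
      = emeasure (PiM I (\<lambda>_. M)) (PiE I C)"
    using A B by (simp add: emeasure_distr)
  also have "\<dots> = (\<Prod>m\<in>I. emeasure M (C m))"
    using A B fin by (intro emeasure_PiM) (auto simp: C_def)
  also have "\<dots> = emeasure M A * (emeasure M B * (\<Prod>m\<in>I - {i} - {j}. emeasure M (C m)))"
    using fin i j \<open>i \<noteq> j\<close> by (simp add: prod.remove[of _ i] prod.remove[of _ j] C_def)
  also have "(\<Prod>m\<in>I - {i} - {j}. emeasure M (C m)) = 1"
    by (intro prod.neutral) (simp add: C_def M.emeasure_space_1)
  finally show "emeasure M A * emeasure M B
      = emeasure (distr (PiM I (\<lambda>_. M)) (M \<Otimes>\<^sub>M M) (\<lambda>x. (x i, x j))) (A \<times> B)"
    by simp
qed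

lemma AE_sample_points_pair:
  assumes "AE p in unit_lborel \<Otimes>\<^sub>M unit_lborel. Q (fst p) (snd p)" and "i < k" "j < k" "i \<noteq> j"
  shows "AE x in sample_points k. Q (x i) (x j)"
proof -
  have "AE p in distr (sample_points k) (unit_lborel \<Otimes>\<^sub>M unit_lborel) (\<lambda>x. (x i, x j)).
      Q (fst p) (snd p)"
    unfolding sample_points_eq
    by (subst distr_PiM_pair) (use assms unit_lborel.prob_space_axioms in auto)
  moreover have "(\<lambda>x. (x i, x j)) \<in> sample_points k \<rightarrow>\<^sub>M unit_lborel \<Otimes>\<^sub>M unit_lborel"
    unfolding sample_points_eq using assms
    by (intro measurable_Pair measurable_component_singleton) auto
  ultimately show ?thesis
    by (auto dest: AE_distrD)
qed

lemma prob_space_sample_points: "prob_space (sample_points k)"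
  unfolding sample_points_eq by (rule prob_space_PiM) (rule unit_lborel.prob_space_axioms)

section \<open>Induced and homomorphism densities\<close>

text \<open>Each unordered pair is represented once, in increasing order, as in the index set of the
  Bernoulli variables of \<open>random_graph_given\<close>.\<close>

definition vertex_pairs :: "nat \<Rightarrow> (nat \<times> nat) set" where
  "vertex_pairs k = {(i, j). i < j \<and> j < k}"

definition edge_graph :: "nat \<Rightarrow> (nat \<times> nat) set \<Rightarrow> sgraph" where
  "edge_graph k E = ({..<k}, (\<lambda>(i, j). {i, j}) ` E)"

text \<open>The labelled copies of \<open>H\<close>; the density of \<open>H\<close> becomes the
  finite sum of their induced densities.\<close>

definition iso_edge_sets :: "nat \<Rightarrow> sgraph \<Rightarrow> (nat \<times> nat) set set" where
  "iso_edge_sets k H = {E. E \<subseteq> vertex_pairs k \<and> graph_iso (edge_graph k E) H}"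

definition edge_weight :: "(real \<Rightarrow> real \<Rightarrow> real) \<Rightarrow> (nat \<Rightarrow> real) \<Rightarrow> nat \<times> nat \<Rightarrow> real" where
  "edge_weight V x e = V (x (fst e)) (x (snd e))"

definition induced_prob ::
    "nat \<Rightarrow> (nat \<times> nat) set \<Rightarrow> (real \<Rightarrow> real \<Rightarrow> real) \<Rightarrow> (nat \<Rightarrow> real) \<Rightarrow> real" where
  "induced_prob k E V x =
     (\<Prod>e\<in>E. edge_weight V x e) * (\<Prod>e\<in>vertex_pairs k - E. 1 - edge_weight V x e)"

text \<open>The homomorphism density, usually written t(F, V). It imposes no condition on non-edges,
  so it merely gets multiplied by a factor when \<open>V\<close> is copied onto the cells of a
  partition.\<close>

definition hom_density :: "nat \<Rightarrow> (nat \<times> nat) set \<Rightarrow> (real \<Rightarrow> real \<Rightarrow> real) \<Rightarrow> real" where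
  "hom_density k F V = (LINT x | sample_points k. (\<Prod>e\<in>F. edge_weight V x e))"

definition induced_density :: "nat \<Rightarrow> (nat \<times> nat) set \<Rightarrow> (real \<Rightarrow> real \<Rightarrow> real) \<Rightarrow> real" where
  "induced_density k E V = (LINT x | sample_points k. induced_prob k E V x)"

lemma finite_vertex_pairs [simp]: "finite (vertex_pairs k)"
  by (rule finite_subset[of _ "{..<k} \<times> {..<k}"]) (auto simp: vertex_pairs_def)

lemma finite_sub_vertex_pairs: "E \<subseteq> vertex_pairs k \<Longrightarrow> finite E"
  by (rule finite_subset) auto

lemma finite_iso_edge_sets [simp]: "finite (iso_edge_sets k H)"
  by (rule finite_subset[of _ "Pow (vertex_pairs k)"]) (auto simp: iso_edge_sets_def)

text \<open>Up to mass 0, an outcome of the independent trials is the indicator \<open>ind E\<close>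
  of an edge set, and its mass is \<open>induced_prob k E V x\<close>.\<close>

lemma prob_random_graph_given:
  assumes V: "\<And>e. e \<in> vertex_pairs k \<Longrightarrow> edge_weight V x e \<in> {0..1}"
  shows "measure_pmf.prob (random_graph_given V k x) {G. graph_iso G H}
    = (\<Sum>E\<in>iso_edge_sets k H. induced_prob k E V x)"
proof -
  define M where "M = Pi_pmf (vertex_pairs k) False (\<lambda>e. bernoulli_pmf (edge_weight V x e))"
  define g where "g = (\<lambda>b. ({..<k}, {{i, j} |i j. i < j \<and> j < k \<and> b (i, j)}))"
  define ind where "ind = (\<lambda>(E :: (nat \<times> nat) set) e. e \<in> E)"
  have g_ind: "g (ind E) = edge_graph k E" if "E \<subseteq> vertex_pairs k" for E
    using that by (auto simp: g_def ind_def edge_graph_def vertex_pairs_def image_iff)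
  have "random_graph_given V k x = map_pmf g M"
    unfolding random_graph_given_def M_def g_def vertex_pairs_def edge_weight_def
    by (simp add: case_prod_unfold)
  then have "measure_pmf.prob (random_graph_given V k x) {G. graph_iso G H}
      = measure_pmf.prob M (g -` {G. graph_iso G H})"
    by simp
  \<comment> \<open>The two events differ only in outcomes that hold at some index outside
    \<open>vertex_pairs k\<close>; the default \<open>False\<close> of \<open>Pi_pmf\<close> gives
    these mass 0.\<close>
  also have "\<dots> = measure_pmf.prob M (ind ` iso_edge_sets k H)"
  proof (rule measure_prob_cong_0)
    fix b assume b: "b \<in> g -` {G. graph_iso G H} - ind ` iso_edge_sets k H"
    show "pmf M b = 0"
    proof (cases "\<forall>e. e \<notin> vertex_pairs k \<longrightarrow> b e = False")
      case True
      define E where "E = {e. b e}"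
      have "b = ind E" "E \<subseteq> vertex_pairs k" using True by (auto simp: ind_def E_def)
      then show ?thesis using b g_ind[of E] by (auto simp: iso_edge_sets_def)
    next
      case False
      then show ?thesis unfolding M_def by (subst pmf_Pi) auto
    qed
  next
    fix b assume "b \<in> ind ` iso_edge_sets k H - g -` {G. graph_iso G H}"
    then show "pmf M b = 0" using g_ind by (auto simp: iso_edge_sets_def)
  qed
  also have "\<dots> = (\<Sum>b\<in>ind ` iso_edge_sets k H. pmf M b)"
    by (rule measure_measure_pmf_finite) simp
  also have "\<dots> = (\<Sum>E\<in>iso_edge_sets k H. pmf M (ind E))"
    by (subst sum.reindex) (auto simp: inj_on_def ind_def fun_eq_iff)
  also have "\<dots> = (\<Sum>E\<in>iso_edge_sets k H. induced_prob k E V x)"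
  proof (rule sum.cong[OF refl])
    fix E assume "E \<in> iso_edge_sets k H"
    then have E: "E \<subseteq> vertex_pairs k" by (simp add: iso_edge_sets_def)
    have "pmf M (ind E) = (\<Prod>e\<in>vertex_pairs k. pmf (bernoulli_pmf (edge_weight V x e)) (e \<in> E))"
      unfolding M_def using E by (subst pmf_Pi') (auto simp: ind_def)
    also have "\<dots> = (\<Prod>e\<in>vertex_pairs k. if e \<in> E then edge_weight V x e else 1 - edge_weight V x e)"
      using V by (intro prod.cong) auto
    also have "\<dots> = induced_prob k E V x"
      using E unfolding induced_prob_def
      by (subst prod.subset_diff[OF E]) (auto intro!: arg_cong2[where f="(*)"] prod.cong)
    finally show "pmf M (ind E) = induced_prob k E V x" .
  qed
  finally show ?thesis .
qed

text \<open>Serves as a Borel representative of a graphon. The bounds hold at all real arguments, so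
  they apply to edge weights without reference to where the sampled points lie.\<close>

locale borel_kernel =
  fixes V :: "real \<Rightarrow> real \<Rightarrow> real"
  assumes V_borel [measurable]: "(\<lambda>p. V (fst p) (snd p)) \<in> borel_measurable (unit_lborel \<Otimes>\<^sub>M unit_lborel)"
    and V_range: "\<And>x y. 0 \<le> V x y \<and> V x y \<le> 1"
begin

lemma edge_weight_range: "0 \<le> edge_weight V x e" "edge_weight V x e \<le> 1"
  using V_range by (auto simp: edge_weight_def)

lemma measurable_edge_weight:
  assumes "e \<in> vertex_pairs k"
  shows "(\<lambda>x. edge_weight V x e) \<in> borel_measurable (sample_points k)"
proof -
  have "(\<lambda>x. (x (fst e), x (snd e))) \<in> sample_points k \<rightarrow>\<^sub>M unit_lborel \<Otimes>\<^sub>M unit_lborel"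
    unfolding sample_points_eq using assms by (auto simp: vertex_pairs_def)
  from measurable_compose[OF this V_borel] show ?thesis
    by (simp add: edge_weight_def)
qed

lemma measurable_prod_edge_weight:
  assumes "F \<subseteq> vertex_pairs k"
  shows "(\<lambda>x. \<Prod>e\<in>F. edge_weight V x e) \<in> borel_measurable (sample_points k)"
  using assms by (intro borel_measurable_prod measurable_edge_weight) auto

lemma prod_edge_weight_range:
  "0 \<le> (\<Prod>e\<in>F. edge_weight V x e)" "(\<Prod>e\<in>F. edge_weight V x e) \<le> 1"
  "0 \<le> (\<Prod>e\<in>F. 1 - edge_weight V x e)" "(\<Prod>e\<in>F. 1 - edge_weight V x e) \<le> 1"
  by (auto intro!: prod_nonneg prod_le_1 simp: edge_weight_range)

lemma integrable_prod_edge_weight: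
  assumes "F \<subseteq> vertex_pairs k"
  shows "integrable (sample_points k) (\<lambda>x. \<Prod>e\<in>F. edge_weight V x e)"
proof -
  interpret prob_space "sample_points k" by (rule prob_space_sample_points)
  show ?thesis
    using prod_edge_weight_range
    by (intro integrable_const_bound[where B = 1] measurable_prod_edge_weight assms) auto
qed

lemma measurable_induced_prob:
  assumes "E \<subseteq> vertex_pairs k"
  shows "induced_prob k E V \<in> borel_measurable (sample_points k)"
  unfolding induced_prob_def[abs_def] using assms
  by (intro borel_measurable_times borel_measurable_prod borel_measurable_diff
      measurable_edge_weight borel_measurable_const) auto

lemma induced_prob_range: "0 \<le> induced_prob k E V x" "induced_prob k E V x \<le> 1"
  unfolding induced_prob_def using prod_edge_weight_range
  by (auto intro!: mult_nonneg_nonneg mult_le_one)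

lemma integrable_induced_prob:
  assumes "E \<subseteq> vertex_pairs k"
  shows "integrable (sample_points k) (induced_prob k E V)"
proof -
  interpret prob_space "sample_points k" by (rule prob_space_sample_points)
  show ?thesis
    using induced_prob_range
    by (intro integrable_const_bound[where B = 1] measurable_induced_prob assms) auto
qed

lemma induced_density_nonneg: "0 \<le> induced_density k E V"
  unfolding induced_density_def using induced_prob_range by simp

text \<open>Inclusion-exclusion: the product of the factors \<open>1 - edge_weight V x e\<close>
  over the non-edges is expanded over the subsets \<open>X\<close> of the non-edges.\<close>

lemma induced_density_eq_hom_density:
  assumes E: "E \<subseteq> vertex_pairs k"
  shows "induced_density k E V
    = (\<Sum>X\<in>Pow (vertex_pairs k - E). (-1) ^ card X * hom_density k (E \<union> X) V)"
proof -
  have expand: "induced_prob k E V x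
      = (\<Sum>X\<in>Pow (vertex_pairs k - E). (-1) ^ card X * (\<Prod>e\<in>E \<union> X. edge_weight V x e))" for x
  proof -
    have "(\<Prod>e\<in>vertex_pairs k - E. 1 - edge_weight V x e)
        = (\<Prod>e\<in>vertex_pairs k - E. - edge_weight V x e + 1)"
      by (simp add: algebra_simps)
    also have "\<dots> = (\<Sum>X\<in>Pow (vertex_pairs k - E). (-1) ^ card X * (\<Prod>e\<in>X. edge_weight V x e))"
      by (subst prod_add) (simp_all add: prod_uminus)
    finally have "induced_prob k E V x = (\<Sum>X\<in>Pow (vertex_pairs k - E).
        (-1) ^ card X * ((\<Prod>e\<in>E. edge_weight V x e) * (\<Prod>e\<in>X. edge_weight V x e)))"
      unfolding induced_prob_def by (simp add: sum_distrib_left mult_ac)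
    also have "\<dots> = (\<Sum>X\<in>Pow (vertex_pairs k - E). (-1) ^ card X * (\<Prod>e\<in>E \<union> X. edge_weight V x e))"
      using E by (intro sum.cong refl arg_cong2[where f="(*)"] prod.union_disjoint[symmetric])
        (auto intro: finite_sub_vertex_pairs)
    finally show ?thesis .
  qed
  then have "induced_density k E V = (LINT x | sample_points k.
      (\<Sum>X\<in>Pow (vertex_pairs k - E). (-1) ^ card X * (\<Prod>e\<in>E \<union> X. edge_weight V x e)))"
    unfolding induced_density_def by (intro Bochner_Integration.integral_cong[OF refl expand])
  also have "\<dots> = (\<Sum>X\<in>Pow (vertex_pairs k - E). (-1) ^ card X * hom_density k (E \<union> X) V)"
    unfolding hom_density_def using E
    by (subst Bochner_Integration.integral_sum) (auto intro!: integrable_prod_edge_weight)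
  finally show ?thesis .
qed

text \<open>Each pair outside \<open>F\<close> contributes a factor 1, written as its weight plus
  the complementary weight; expanding decides for each such pair whether it is an edge.\<close>

lemma hom_density_eq_induced_density:
  assumes F: "F \<subseteq> vertex_pairs k"
  shows "hom_density k F V = (\<Sum>X\<in>Pow (vertex_pairs k - F). induced_density k (F \<union> X) V)"
proof -
  have "(\<Prod>e\<in>F. edge_weight V x e) = (\<Sum>X\<in>Pow (vertex_pairs k - F). induced_prob k (F \<union> X) V x)" for x
  proof -
    have "(\<Prod>e\<in>F. edge_weight V x e)
        = (\<Prod>e\<in>F. edge_weight V x e) * (\<Prod>e\<in>vertex_pairs k - F. edge_weight V x e + (1 - edge_weight V x e))"
      by simp
    also have "\<dots> = (\<Sum>X\<in>Pow (vertex_pairs k - F). ((\<Prod>e\<in>F. edge_weight V x e) * (\<Prod>e\<in>X. edge_weight V x e))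
        * (\<Prod>e\<in>vertex_pairs k - F - X. 1 - edge_weight V x e))"
      by (subst prod_add) (simp_all add: sum_distrib_left mult_ac)
    also have "\<dots> = (\<Sum>X\<in>Pow (vertex_pairs k - F). induced_prob k (F \<union> X) V x)"
      unfolding induced_prob_def using F
      by (intro sum.cong refl arg_cong2[where f="(*)"] prod.union_disjoint[symmetric])
        (auto intro: finite_sub_vertex_pairs simp: Diff_Un set_diff_eq Int_def conj_ac)
    finally show ?thesis .
  qed
  then show ?thesis
    unfolding hom_density_def induced_density_def using F
    by (subst Bochner_Integration.integral_sum[symmetric]) (auto intro!: integrable_induced_prob)
qed

lemma graph_density_eq:
  assumes ae: "AE p in unit_lborel \<Otimes>\<^sub>M unit_lborel. W (fst p) (snd p) = V (fst p) (snd p)"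
    and k: "k = card (fst H)"
  shows "graph_density H W = (\<Sum>E\<in>iso_edge_sets k H. induced_density k E V)"
proof -
  let ?w = "\<lambda>W x. measure_pmf.prob (random_graph_given W k x) {G. graph_iso G H}"
  let ?f = "\<lambda>x. \<Sum>E\<in>iso_edge_sets k H. induced_prob k E V x"
  have "AE x in sample_points k. \<forall>e\<in>vertex_pairs k. edge_weight W x e = edge_weight V x e"
    unfolding edge_weight_def
    by (intro AE_finite_allI finite_vertex_pairs AE_sample_points_pair[OF ae])
      (auto simp: vertex_pairs_def)
  then have eq: "AE x in sample_points k. ?w W x = ?f x"
  proof eventually_elim
    fix x assume *: "\<forall>e\<in>vertex_pairs k. edge_weight W x e = edge_weight V x e"
    have "?w W x = (\<Sum>E\<in>iso_edge_sets k H. induced_prob k E W x)"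
      using * edge_weight_range by (intro prob_random_graph_given) auto
    also have "\<dots> = ?f x"
      using * unfolding induced_prob_def
      by (intro sum.cong refl arg_cong2[where f="(*)"] prod.cong) (auto simp: iso_edge_sets_def)
    finally show "?w W x = ?f x" .
  qed
  have f: "?f \<in> borel_measurable (sample_points k)"
    by (intro borel_measurable_sum measurable_induced_prob) (auto simp: iso_edge_sets_def)
  have "graph_density H W = (LINT x | completion (sample_points k). ?f x)"
    unfolding graph_density_def k[symmetric]
  proof (rule integral_cong_AE)
    show "?f \<in> borel_measurable (completion (sample_points k))"
      using f by (rule measurable_completion)
    show ae': "AE x in completion (sample_points k). ?w W x = ?f x"
      using eq by (rule AE_completion)
    show "?w W \<in> borel_measurable (completion (sample_points k))"
      using eq f by (rule borel_measurable_completion_AE)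
  qed
  also have "\<dots> = (LINT x | sample_points k. ?f x)"
    using f by (rule integral_completion)
  also have "\<dots> = (\<Sum>E\<in>iso_edge_sets k H. induced_density k E V)"
    unfolding induced_density_def
    by (subst Bochner_Integration.integral_sum) (auto intro!: integrable_induced_prob simp: iso_edge_sets_def)
  finally show ?thesis .
qed

end

section \<open>Labellings that are constant on components\<close>

lemma distr_PiM_map:
  assumes P: "prob_space P" and f [measurable]: "f \<in> P \<rightarrow>\<^sub>M N" and fin: "finite I"
  shows "distr (PiM I (\<lambda>_. P)) (PiM I (\<lambda>_. N)) (\<lambda>x. \<lambda>i\<in>I. f (x i)) = PiM I (\<lambda>_. distr P N f)"
proof -
  interpret P: prob_space P by fact
  interpret N: prob_space "distr P N f" by (rule P.prob_space_distr) fact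
  interpret PP: product_prob_space "\<lambda>_. P" I by unfold_locales
  interpret NN: product_prob_space "\<lambda>_. distr P N f" I by unfold_locales
  show ?thesis
  proof (rule NN.PiM_eqI)
    show "finite I" by fact
    show "sets (distr (PiM I (\<lambda>_. P)) (PiM I (\<lambda>_. N)) (\<lambda>x. \<lambda>i\<in>I. f (x i))) = sets (PiM I (\<lambda>_. distr P N f))"
      by (simp cong: sets_PiM_cong)
    fix A assume "\<And>i. i \<in> I \<Longrightarrow> A i \<in> sets (distr P N f)"
    then have A: "\<And>i. i \<in> I \<Longrightarrow> A i \<in> sets N" by simp
    have "(\<lambda>x. \<lambda>i\<in>I. f (x i)) -` PiE I A \<inter> space (PiM I (\<lambda>_. P)) = PiE I (\<lambda>i. f -` A i \<inter> space P)"
      by (auto simp: space_PiM PiE_iff)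
    then have "emeasure (distr (PiM I (\<lambda>_. P)) (PiM I (\<lambda>_. N)) (\<lambda>x. \<lambda>i\<in>I. f (x i))) (PiE I A)
        = emeasure (PiM I (\<lambda>_. P)) (PiE I (\<lambda>i. f -` A i \<inter> space P))"
      using A fin by (subst emeasure_distr) (auto intro!: sets_PiM_I_finite)
    also have "\<dots> = (\<Prod>i\<in>I. emeasure (distr P N f) (A i))"
      using A fin by (subst PP.emeasure_PiM) (auto simp: emeasure_distr intro!: prod.cong)
    finally show "emeasure (distr (PiM I (\<lambda>_. P)) (PiM I (\<lambda>_. N)) (\<lambda>x. \<lambda>i\<in>I. f (x i))) (PiE I A)
        = (\<Prod>i\<in>I. emeasure (distr P N f) (A i))" .
  qed
qed

text \<open>Over a fixed \<open>x\<close> the section of a box is again a box, so Tonelli turns its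
  measure into the product of the measures of the \<open>A i\<close>. Independent pairs can thus be
  drawn as all first components and then all second components.\<close>

lemma distr_pair_PiM_zip:
  assumes Q: "prob_space Q" and P: "prob_space P" and fin: "finite I"
  shows "distr (PiM I (\<lambda>_. Q) \<Otimes>\<^sub>M PiM I (\<lambda>_. P)) (PiM I (\<lambda>_. Q \<Otimes>\<^sub>M P))
      (\<lambda>(x, y). \<lambda>i\<in>I. (x i, y i)) = PiM I (\<lambda>_. Q \<Otimes>\<^sub>M P)"
proof -
  interpret Q: prob_space Q by fact
  interpret P: prob_space P by fact
  interpret QP: pair_prob_space Q P by unfold_locales
  interpret PQ: product_prob_space "\<lambda>_. Q" I by unfold_locales
  interpret PP: product_prob_space "\<lambda>_. P" I by unfold_locales
  interpret NN: product_prob_space "\<lambda>_. Q \<Otimes>\<^sub>M P" I by unfold_locales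
  have PIP: "sigma_finite_measure (PiM I (\<lambda>_. P))"
    by (intro prob_space_imp_sigma_finite prob_space_PiM P)
  let ?z = "\<lambda>(x, y). \<lambda>i\<in>I. (x i, y i)"
  have z [measurable]: "?z \<in> PiM I (\<lambda>_. Q) \<Otimes>\<^sub>M PiM I (\<lambda>_. P) \<rightarrow>\<^sub>M PiM I (\<lambda>_. Q \<Otimes>\<^sub>M P)"
    by measurable
  show ?thesis
  proof (rule NN.PiM_eqI)
    show "finite I" by fact
    fix A assume A: "\<And>i. i \<in> I \<Longrightarrow> A i \<in> sets (Q \<Otimes>\<^sub>M P)"
    let ?D = "PiM I (\<lambda>_. Q) \<Otimes>\<^sub>M PiM I (\<lambda>_. P)"
    have B: "PiE I A \<in> sets (PiM I (\<lambda>_. Q \<Otimes>\<^sub>M P))"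
      using A fin by (intro sets_PiM_I_finite) auto
    have "emeasure (distr ?D (PiM I (\<lambda>_. Q \<Otimes>\<^sub>M P)) ?z) (PiE I A) = emeasure ?D (?z -` PiE I A \<inter> space ?D)"
      using B by (intro emeasure_distr z)
    also have "\<dots> = (\<integral>\<^sup>+ x. emeasure (PiM I (\<lambda>_. P)) (Pair x -` (?z -` PiE I A \<inter> space ?D)) \<partial>PiM I (\<lambda>_. Q))"
      using measurable_sets[OF z B] by (intro sigma_finite_measure.emeasure_pair_measure_alt[OF PIP])
    also have "\<dots> = (\<integral>\<^sup>+ x. (\<Prod>i\<in>I. emeasure P (Pair (x i) -` A i)) \<partial>PiM I (\<lambda>_. Q))"
    proof (rule nn_integral_cong)
      fix x assume x: "x \<in> space (PiM I (\<lambda>_. Q))"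
      have "Pair x -` (?z -` PiE I A \<inter> space ?D) = PiE I (\<lambda>i. Pair (x i) -` A i)"
        using x A[THEN sets.sets_into_space]
        by (auto simp: space_PiM PiE_iff space_pair_measure)
      then show "emeasure (PiM I (\<lambda>_. P)) (Pair x -` (?z -` PiE I A \<inter> space ?D))
          = (\<Prod>i\<in>I. emeasure P (Pair (x i) -` A i))"
        using A fin by (simp add: PP.emeasure_PiM sets_Pair1)
    qed
    also have "\<dots> = (\<Prod>i\<in>I. \<integral>\<^sup>+ x. emeasure P (Pair x -` A i) \<partial>Q)"
      using A fin by (intro PQ.product_nn_integral_prod P.measurable_emeasure_Pair) auto
    also have "\<dots> = (\<Prod>i\<in>I. emeasure (Q \<Otimes>\<^sub>M P) (A i))"
      using A by (intro prod.cong refl P.emeasure_pair_measure_alt[symmetric])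
    finally show "emeasure (distr ?D (PiM I (\<lambda>_. Q \<Otimes>\<^sub>M P)) ?z) (PiE I A)
        = (\<Prod>i\<in>I. emeasure (Q \<Otimes>\<^sub>M P) (A i))" .
  qed simp
qed

text \<open>A labelling that is constant on the fibres of \<open>g\<close> amounts to one label per
  fibre. There are countably many, so the measure is a sum over them, and a fibre contributes the
  mass of its label to the power of its size.\<close>

lemma emeasure_PiM_constant_on_fibres:
  fixes Q :: "nat measure" and g :: "'i \<Rightarrow> 'c"
  assumes Q: "prob_space Q" and sQ: "sets Q = UNIV" and fin: "finite I"
  shows "emeasure (PiM I (\<lambda>_. Q)) {x \<in> PiE I (\<lambda>_. UNIV). \<forall>i\<in>I. \<forall>j\<in>I. g i = g j \<longrightarrow> x i = x j}
    = (\<Prod>c\<in>g ` I. \<Sum>m. emeasure Q {m} ^ card {i \<in> I. g i = c})"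
proof -
  interpret Q: prob_space Q by fact
  interpret PQ: product_prob_space "\<lambda>_. Q" I by unfold_locales
  let ?X = "{x \<in> PiE I (\<lambda>_. UNIV :: nat set). \<forall>i\<in>I. \<forall>j\<in>I. g i = g j \<longrightarrow> x i = x j}"
  let ?Y = "PiE (g ` I) (\<lambda>_. UNIV :: nat set)"
  have single: "{x} \<in> sets (PiM I (\<lambda>_. Q)) \<and> emeasure (PiM I (\<lambda>_. Q)) {x} = (\<Prod>i\<in>I. emeasure Q {x i})"
    if "x \<in> ?X" for x
  proof
    have "x \<in> extensional I" using that by (blast dest: PiE_iff[THEN iffD1])
    then have eq: "{x} = PiE I (\<lambda>i. {x i})" by (rule PiE_singleton[symmetric])
    show "{x} \<in> sets (PiM I (\<lambda>_. Q))"
      unfolding eq by (rule sets_PiM_I_finite[OF fin]) (simp add: sQ)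
    show "emeasure (PiM I (\<lambda>_. Q)) {x} = (\<Prod>i\<in>I. emeasure Q {x i})"
      by (subst eq, rule PQ.emeasure_PiM[OF fin]) (simp add: sQ)
  qed
  have bij: "bij_betw (\<lambda>y. \<lambda>i\<in>I. y (g i)) ?Y ?X"
    unfolding bij_betw_def
  proof
    show "inj_on (\<lambda>y. \<lambda>i\<in>I. y (g i)) ?Y"
    proof (rule inj_onI)
      fix y z assume y: "y \<in> ?Y" and z: "z \<in> ?Y" and eq: "(\<lambda>i\<in>I. y (g i)) = (\<lambda>i\<in>I. z (g i))"
      show "y = z"
      proof (rule PiE_ext[OF y z])
        fix c assume "c \<in> g ` I"
        then obtain i where "i \<in> I" "c = g i" by blast
        then show "y c = z c" using fun_cong[OF eq, of i] by simp
      qed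
    qed
    show "(\<lambda>y. \<lambda>i\<in>I. y (g i)) ` ?Y = ?X"
    proof (intro equalityI subsetI)
      fix x assume "x \<in> (\<lambda>y. \<lambda>i\<in>I. y (g i)) ` ?Y"
      then show "x \<in> ?X" by auto
    next
      fix x assume x: "x \<in> ?X"
      then have ext: "x \<in> extensional I" by (blast dest: PiE_iff[THEN iffD1])
      \<comment> \<open>A fibre receives the value of \<open>x\<close> at a chosen representative,
        and constancy on the fibre makes the choice immaterial.\<close>
      define y where "y = (\<lambda>c\<in>g ` I. x (SOME i. i \<in> I \<and> g i = c))"
      have "x i = y (g i)" if "i \<in> I" for i
      proof -
        have "(SOME j. j \<in> I \<and> g j = g i) \<in> I \<and> g (SOME j. j \<in> I \<and> g j = g i) = g i"
          using that by (intro someI[of "\<lambda>j. j \<in> I \<and> g j = g i" i]) auto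
        moreover have "\<forall>i\<in>I. \<forall>j\<in>I. g i = g j \<longrightarrow> x i = x j" using x by blast
        ultimately have "x i = x (SOME j. j \<in> I \<and> g j = g i)" using that by metis
        then show ?thesis using that by (simp add: y_def)
      qed
      then have "x = (\<lambda>i\<in>I. y (g i))"
        using ext by (intro extensionalityI[of x I]) auto
      moreover have "y \<in> ?Y" by (auto simp: y_def)
      ultimately show "x \<in> (\<lambda>y. \<lambda>i\<in>I. y (g i)) ` ?Y" by blast
    qed
  qed
  have "emeasure (PiM I (\<lambda>_. Q)) ?X = (\<integral>\<^sup>+x. emeasure (PiM I (\<lambda>_. Q)) {x} \<partial>count_space ?X)"
  proof (rule emeasure_countable_singleton)
    have "countable (PiE I (\<lambda>_. UNIV :: nat set))" using fin by (intro countable_PiE) auto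
    then show "countable ?X" by (rule countable_subset[rotated]) auto
    show "{x} \<in> sets (PiM I (\<lambda>_. Q))" if "x \<in> ?X" for x
      using single[OF that] by (rule conjunct1)
  qed
  also have "\<dots> = (\<integral>\<^sup>+x. (\<Prod>i\<in>I. emeasure Q {x i}) \<partial>count_space ?X)"
    using single by (intro nn_integral_cong) (metis (no_types, lifting) space_count_space)
  also have "\<dots> = (\<integral>\<^sup>+y. (\<Prod>i\<in>I. emeasure Q {(\<lambda>i\<in>I. y (g i)) i}) \<partial>count_space ?Y)"
    by (rule nn_integral_bij_count_space[OF bij, symmetric])
  also have "\<dots> = (\<integral>\<^sup>+y. (\<Prod>c\<in>g ` I. emeasure Q {y c} ^ card {i \<in> I. g i = c}) \<partial>count_space ?Y)"
  proof (rule nn_integral_cong)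
    fix y :: "'c \<Rightarrow> nat"
    have "(\<Prod>i\<in>I. emeasure Q {(\<lambda>i\<in>I. y (g i)) i}) = (\<Prod>i\<in>I. emeasure Q {y (g i)})"
      by (intro prod.cong) auto
    also have "\<dots> = (\<Prod>c\<in>g ` I. \<Prod>i\<in>{i \<in> I. g i = c}. emeasure Q {y (g i)})"
      using fin by (intro prod.group[symmetric]) auto
    also have "\<dots> = (\<Prod>c\<in>g ` I. emeasure Q {y c} ^ card {i \<in> I. g i = c})"
      by (intro prod.cong) (auto simp: prod_constant)
    finally show "(\<Prod>i\<in>I. emeasure Q {(\<lambda>i\<in>I. y (g i)) i})
        = (\<Prod>c\<in>g ` I. emeasure Q {y c} ^ card {i \<in> I. g i = c})" .
  qed
  \<comment> \<open>The sum over all label assignments is read as an integral over a product of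
    counting measures, so that it splits into a product of sums, one for each fibre.\<close>
  also have "\<dots> = (\<integral>\<^sup>+y. (\<Prod>c\<in>g ` I. emeasure Q {y c} ^ card {i \<in> I. g i = c})
      \<partial>PiM (g ` I) (\<lambda>_. count_space UNIV))"
    using fin by (subst count_space_PiM_finite) auto
  also have "\<dots> = (\<Prod>c\<in>g ` I. \<integral>\<^sup>+m. emeasure Q {m} ^ card {i \<in> I. g i = c} \<partial>count_space UNIV)"
  proof -
    interpret product_sigma_finite "\<lambda>_ :: 'c. count_space (UNIV :: nat set)"
      by (simp add: product_sigma_finite_def sigma_finite_measure_count_space)
    show ?thesis
      using fin by (intro product_nn_integral_prod[where f = "\<lambda>c m. emeasure Q {m} ^ card {i \<in> I. g i = c}"]) auto
  qed
  finally show ?thesis by (simp add: nn_integral_count_space_nat)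
qed

text \<open>Two vertices lie in the same component of \<open>F\<close> if and only if they get the same value under
  every labelling that is constant along \<open>F\<close>; this avoids paths and transitive closures.\<close>

definition edge_component :: "nat \<Rightarrow> (nat \<times> nat) set \<Rightarrow> nat \<Rightarrow> nat set" where
  "edge_component k F i =
     {v. v < k \<and> (\<forall>x :: nat \<Rightarrow> nat. (\<forall>e\<in>F. x (fst e) = x (snd e)) \<longrightarrow> x i = x v)}"

text \<open>With the law of the cell of a uniform point as \<open>Q\<close>, this is the probability
  that no edge of \<open>F\<close> joins sample points in different cells.\<close>

definition label_agreement_prob :: "nat measure \<Rightarrow> nat \<Rightarrow> (nat \<times> nat) set \<Rightarrow> real" where
  "label_agreement_prob Q k F = measure (PiM {..<k} (\<lambda>_. Q))
     {x \<in> space (PiM {..<k} (\<lambda>_. Q)). \<forall>e\<in>F. x (fst e) = x (snd e)}"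

text \<open>A labelling agrees along \<open>F\<close> exactly if it is constant on the components: a
  vertex lies in its own component, and the two ends of an edge have the same component.\<close>

lemma label_agreement_prob_eq:
  fixes Q :: "nat measure"
  assumes Q: "prob_space Q" and sQ: "sets Q = UNIV" and F: "F \<subseteq> vertex_pairs k"
  shows "label_agreement_prob Q k F = enn2real (\<Prod>c\<in>edge_component k F ` {..<k}.
    \<Sum>m. emeasure Q {m} ^ card {i \<in> {..<k}. edge_component k F i = c})"
proof -
  have "(\<forall>e\<in>F. x (fst e) = x (snd e)) =
      (\<forall>i\<in>{..<k}. \<forall>j\<in>{..<k}. edge_component k F i = edge_component k F j \<longrightarrow> x i = x j)" for x :: "nat \<Rightarrow> nat"
  proof
    assume x: "\<forall>e\<in>F. x (fst e) = x (snd e)"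
    show "\<forall>i\<in>{..<k}. \<forall>j\<in>{..<k}. edge_component k F i = edge_component k F j \<longrightarrow> x i = x j"
    proof (intro ballI impI)
      fix i j assume "i \<in> {..<k}" "j \<in> {..<k}" "edge_component k F i = edge_component k F j"
      moreover have "j \<in> edge_component k F j" if "j < k" for j
        using that by (simp add: edge_component_def)
      ultimately have "j \<in> edge_component k F i" by blast
      then show "x i = x j" using x unfolding edge_component_def by blast
    qed
  next
    assume x: "\<forall>i\<in>{..<k}. \<forall>j\<in>{..<k}. edge_component k F i = edge_component k F j \<longrightarrow> x i = x j"
    show "\<forall>e\<in>F. x (fst e) = x (snd e)"
    proof
      fix e assume e: "e \<in> F"
      then have "edge_component k F (fst e) = edge_component k F (snd e)"
      proof -
        have "z (fst e) = z v \<longleftrightarrow> z (snd e) = z v" if "\<forall>e\<in>F. z (fst e) = z (snd e)" for z :: "nat \<Rightarrow> nat" and v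
          using bspec[OF that e] by simp
        then show ?thesis
          unfolding edge_component_def by (intro Collect_cong conj_cong refl all_cong1 imp_cong)
      qed
      moreover have "fst e \<in> {..<k}" "snd e \<in> {..<k}" using e F by (auto simp: vertex_pairs_def)
      ultimately show "x (fst e) = x (snd e)" using x by blast
    qed
  qed
  then have eq: "(\<lambda>x :: nat \<Rightarrow> nat. \<forall>e\<in>F. x (fst e) = x (snd e)) = (\<lambda>x.
      \<forall>i\<in>{..<k}. \<forall>j\<in>{..<k}. edge_component k F i = edge_component k F j \<longrightarrow> x i = x j)"
    by (rule ext)
  have "space Q = UNIV" using sQ sets.top sets_eq_imp_space_eq[of Q "count_space UNIV"] by simp
  then show ?thesis
    unfolding label_agreement_prob_def measure_def
    by (simp only: eq[THEN fun_cong] space_PiM emeasure_PiM_constant_on_fibres[OF Q sQ finite_lessThan, symmetric])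
qed

text \<open>The exponents are the sizes of the components, which lie between 1 and
  \<open>k\<close>.\<close>

lemma label_agreement_prob_cong:
  fixes Q Q' :: "nat measure"
  assumes Q: "prob_space Q" "sets Q = UNIV" and Q': "prob_space Q'" "sets Q' = UNIV"
    and F: "F \<subseteq> vertex_pairs k"
    and eq: "\<And>l. 1 \<le> l \<Longrightarrow> l \<le> k \<Longrightarrow> (\<Sum>m. emeasure Q {m} ^ l) = (\<Sum>m. emeasure Q' {m} ^ l)"
  shows "label_agreement_prob Q k F = label_agreement_prob Q' k F"
proof -
  have "(\<Sum>m. emeasure Q {m} ^ card {i \<in> {..<k}. edge_component k F i = c})
      = (\<Sum>m. emeasure Q' {m} ^ card {i \<in> {..<k}. edge_component k F i = c})"
    if "c \<in> edge_component k F ` {..<k}" for c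
  proof (rule eq)
    have "{i \<in> {..<k}. edge_component k F i = c} \<noteq> {}" using that by auto
    then show "1 \<le> card {i \<in> {..<k}. edge_component k F i = c}"
      by (simp add: Suc_le_eq card_gt_0_iff)
    show "card {i \<in> {..<k}. edge_component k F i = c} \<le> k"
      using card_mono[OF finite_lessThan, of "{i \<in> {..<k}. edge_component k F i = c}" k] by auto
  qed
  then show ?thesis
    using F Q Q' by (simp add: label_agreement_prob_eq cong: prod.cong)
qed

text \<open>Connectedness in the labelling form of \<open>edge_component\<close>, so that there is a
  single component when \<open>k\<close> is positive.\<close>

definition connected_pairs :: "nat \<Rightarrow> (nat \<times> nat) set \<Rightarrow> bool" where
  "connected_pairs k F \<longleftrightarrow> (\<forall>x :: nat \<Rightarrow> nat. (\<forall>e\<in>F. x (fst e) = x (snd e)) \<longrightarrow>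
     (\<forall>i<k. \<forall>j<k. x i = x j))"

lemma label_agreement_prob_connected:
  fixes Q :: "nat measure"
  assumes Q: "prob_space Q" and sQ: "sets Q = UNIV" and F: "F \<subseteq> vertex_pairs k"
    and conn: "connected_pairs k F" and "0 < k"
  shows "label_agreement_prob Q k F = enn2real (\<Sum>m. emeasure Q {m} ^ k)"
proof -
  have "edge_component k F i = {..<k}" if "i < k" for i
    using conn that unfolding connected_pairs_def edge_component_def by blast
  then have "edge_component k F ` {..<k} = {{..<k}}"
    "{i \<in> {..<k}. edge_component k F i = {..<k}} = {..<k}"
    using \<open>0 < k\<close> by auto
  then show ?thesis by (simp add: label_agreement_prob_eq[OF Q sQ F])
qed

section \<open>Graphons up to null sets\<close>

lemma unit_square_borel [simp]: "{0..1} \<times> {0..1} \<in> sets (borel :: (real \<times> real) measure)"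
  by (intro borel_closed closed_Times) auto

text \<open>The identity is measurable in both directions, and the measures agree on rectangles.
  This ties the sampling measure to the Lebesgue measure in \<open>graphon\<close>.\<close>

lemma unit_lborel_pair_eq:
  "unit_lborel \<Otimes>\<^sub>M unit_lborel = restrict_space lborel ({0..1} \<times> {0..1} :: (real \<times> real) set)"
    (is "_ = ?R")
proof (rule pair_measure_eqI)
  have sp: "space ?R = space (unit_lborel \<Otimes>\<^sub>M unit_lborel)"
    by (simp add: space_restrict_space space_pair_measure)
  have 1: "(\<lambda>p. p) \<in> ?R \<rightarrow>\<^sub>M unit_lborel \<Otimes>\<^sub>M unit_lborel"
  proof (rule measurable_pair)
    have "fst \<in> ?R \<rightarrow>\<^sub>M lborel" "snd \<in> ?R \<rightarrow>\<^sub>M lborel"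
      by (auto intro!: measurable_restrict_space1 simp flip: borel_prod)
    then show "fst \<circ> (\<lambda>p. p) \<in> ?R \<rightarrow>\<^sub>M unit_lborel" "snd \<circ> (\<lambda>p. p) \<in> ?R \<rightarrow>\<^sub>M unit_lborel"
      unfolding unit_lborel_def by (auto intro!: measurable_restrict_space2 simp: space_restrict_space comp_def)
  qed
  have "(\<lambda>p. (fst p, snd p)) \<in> unit_lborel \<Otimes>\<^sub>M unit_lborel \<rightarrow>\<^sub>M borel \<Otimes>\<^sub>M borel"
    by measurable
  then have "(\<lambda>p. p) \<in> unit_lborel \<Otimes>\<^sub>M unit_lborel \<rightarrow>\<^sub>M lborel"
    by (simp add: borel_prod)
  then have 2: "(\<lambda>p. p) \<in> unit_lborel \<Otimes>\<^sub>M unit_lborel \<rightarrow>\<^sub>M ?R"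
    by (intro measurable_restrict_space2) (auto simp: space_pair_measure)
  show sets: "sets (unit_lborel \<Otimes>\<^sub>M unit_lborel) = sets ?R"
  proof (intro equalityI subsetI)
    fix A assume "A \<in> sets (unit_lborel \<Otimes>\<^sub>M unit_lborel)"
    then show "A \<in> sets ?R"
      using measurable_sets[OF 1, of A] sets.sets_into_space[of A "unit_lborel \<Otimes>\<^sub>M unit_lborel"] sp
      by (simp add: Int_absorb2)
  next
    fix A assume "A \<in> sets ?R"
    then show "A \<in> sets (unit_lborel \<Otimes>\<^sub>M unit_lborel)"
      using measurable_sets[OF 2, of A] sets.sets_into_space[of A ?R] sp
      by (simp add: Int_absorb2)
  qed
  fix A B assume AB: "A \<in> sets unit_lborel" "B \<in> sets unit_lborel"
  then have AB': "A \<subseteq> {0..1}" "B \<subseteq> {0..1}" "A \<in> sets borel" "B \<in> sets borel"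
    using sets.sets_into_space[OF AB(1)] sets.sets_into_space[OF AB(2)]
    by (auto simp: unit_lborel_def sets_restrict_space_iff)
  then have "emeasure ?R (A \<times> B) = emeasure lborel (A \<times> B)"
    by (subst emeasure_restrict_space) auto
  also have "\<dots> = emeasure lborel A * emeasure lborel B"
    using AB' by (subst lborel_prod[symmetric]) (simp add: lborel.emeasure_pair_measure_Times)
  finally show "emeasure unit_lborel A * emeasure unit_lborel B = emeasure ?R (A \<times> B)"
    using AB by (simp add: emeasure_unit_lborel)
qed unfold_locales

lemma AE_lebesgue_on_unit_square_iff:
  "(AE p in lebesgue_on ({0..1} \<times> {0..1} :: (real \<times> real) set). Q p) \<longleftrightarrow>
   (AE p in unit_lborel \<Otimes>\<^sub>M unit_lborel. Q p)"
  unfolding unit_lborel_pair_eq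
  by (subst (1 2) AE_restrict_space_iff) (auto simp: AE_completion_iff intro!: sets_completionI_sets)

text \<open>Extended by 0 to the plane, \<open>W\<close> is Lebesgue measurable and hence almost
  everywhere equal to a Borel function \<open>g\<close>.\<close>

lemma graphon_ex_borel_kernel:
  assumes "graphon W"
  obtains V where "borel_kernel V"
    "AE p in unit_lborel \<Otimes>\<^sub>M unit_lborel. W (fst p) (snd p) = V (fst p) (snd p)"
proof -
  let ?S = "{0..1} \<times> {0..1} :: (real \<times> real) set"
  have S: "?S \<in> sets lborel" by simp
  have "(\<lambda>p. W (fst p) (snd p)) \<in> borel_measurable (lebesgue_on ?S)"
    using assms by (simp add: graphon_def case_prod_unfold)
  then have "(\<lambda>p. if p \<in> ?S then W (fst p) (snd p) else 0) \<in> borel_measurable lebesgue"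
    using S by (subst borel_measurable_if) auto
  then obtain g where g: "g \<in> borel_measurable lborel"
    "AE p in lborel. (if p \<in> ?S then W (fst p) (snd p) else 0) = g p"
    using completion_ex_borel_measurable_real by blast
  \<comment> \<open>Truncation enforces the bounds at all arguments and changes nothing where
    \<open>g\<close> agrees with \<open>W\<close> on the square.\<close>
  define V where "V = (\<lambda>x y. max 0 (min 1 (g (x, y))))"
  have "g \<in> borel_measurable (unit_lborel \<Otimes>\<^sub>M unit_lborel)"
    using g(1) unfolding unit_lborel_pair_eq by (rule measurable_restrict_space1)
  then have "borel_kernel V"
    by unfold_locales (auto simp: V_def)
  moreover have "AE p in unit_lborel \<Otimes>\<^sub>M unit_lborel. W (fst p) (snd p) = V (fst p) (snd p)"
    unfolding unit_lborel_pair_eq AE_restrict_space_iff[of ?S lborel, simplified]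
    using g(2)
  proof eventually_elim
    case (elim p)
    show ?case
    proof
      assume p: "p \<in> ?S"
      then have "fst p \<in> {0..1}" "snd p \<in> {0..1}" by (simp_all add: mem_Times_iff)
      then have "W (fst p) (snd p) \<in> {0..1}" using assms unfolding graphon_def by blast
      moreover have "W (fst p) (snd p) = g p" using elim p by simp
      ultimately show "W (fst p) (snd p) = V (fst p) (snd p)" by (simp add: V_def)
    qed
  qed
  ultimately show thesis by (rule that)
qed

text \<open>Supplies the measurability clause of \<open>graphon\<close> for
  \<open>graphon_to_seq a W\<close>; it rests on the completeness of Lebesgue measure.\<close>

lemma (in borel_kernel) borel_measurable_lebesgue_on_unit_square:
  assumes ae: "AE p in unit_lborel \<Otimes>\<^sub>M unit_lborel. W (fst p) (snd p) = V (fst p) (snd p)"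
  shows "(\<lambda>(x, y). W x y) \<in> borel_measurable (lebesgue_on ({0..1} \<times> {0..1}))"
proof -
  let ?S = "{0..1} \<times> {0..1} :: (real \<times> real) set"
  have "(\<lambda>p. if p \<in> ?S then V (fst p) (snd p) else 0) \<in> borel_measurable lborel"
    using V_borel unfolding unit_lborel_pair_eq by (subst (asm) measurable_restrict_space_iff[where c = 0]) auto
  moreover have "AE p in lborel. (if p \<in> ?S then W (fst p) (snd p) else 0) = (if p \<in> ?S then V (fst p) (snd p) else 0)"
    using ae unfolding unit_lborel_pair_eq AE_restrict_space_iff[of ?S lborel, simplified]
    by eventually_elim auto
  ultimately have "(\<lambda>p. if p \<in> ?S then W (fst p) (snd p) else 0) \<in> borel_measurable lebesgue"
    by (intro borel_measurable_completion_AE)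
  then have "(\<lambda>p. W (fst p) (snd p)) \<in> borel_measurable (lebesgue_on ?S)"
    by (subst (asm) borel_measurable_if) auto
  then show ?thesis by (simp add: case_prod_unfold)
qed

section \<open>Partitions of the unit interval\<close>

text \<open>Strict positivity makes every cell a nondegenerate interval, so that rescaling a cell
  divides by a nonzero length.\<close>

locale unit_partition =
  fixes a :: "nat \<Rightarrow> real"
  assumes pos: "\<And>j. 0 < a j" and sums_1: "a sums 1"
begin

definition left_end :: "nat \<Rightarrow> real" where
  "left_end j = (\<Sum>i<j. a i)"

lemma left_end_Suc: "left_end (Suc j) = left_end j + a j"
  by (simp add: left_end_def)

lemma strict_mono_left_end: "strict_mono left_end"
  by (simp add: strict_mono_Suc_iff left_end_Suc pos)

lemma left_end_nonneg: "0 \<le> left_end j"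
  unfolding left_end_def by (intro sum_nonneg less_imp_le pos)

lemma left_end_less_1: "left_end j < 1"
proof -
  have "left_end \<longlonglongrightarrow> 1" using sums_1 by (simp add: sums_def left_end_def[abs_def])
  then have "left_end (Suc j) \<le> 1"
    using strict_mono_left_end by (intro incseq_le) (auto simp: strict_mono_mono)
  then show ?thesis using left_end_Suc[of j] pos[of j] by linarith
qed

lemma part_index_eq:
  assumes "left_end j \<le> x" "x < left_end (Suc j)"
  shows "part_index a x = j"
  unfolding part_index_def
proof (rule the_equality)
  show "(\<Sum>i<j. a i) \<le> x \<and> x < (\<Sum>i\<le>j. a i)"
    using assms by (simp add: left_end_def lessThan_Suc_atMost)
  fix m assume "(\<Sum>i<m. a i) \<le> x \<and> x < (\<Sum>i\<le>m. a i)"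
  then have m: "left_end m \<le> x" "x < left_end (Suc m)"
    by (simp_all add: left_end_def lessThan_Suc_atMost)
  have "\<not> Suc m \<le> j" "\<not> Suc j \<le> m"
    using assms m strict_mono_less_eq[OF strict_mono_left_end] by (meson not_le order_trans)+
  then show "m = j" by simp
qed

lemma ex_part:
  assumes "0 \<le> x" "x < 1"
  shows "\<exists>j. left_end j \<le> x \<and> x < left_end (Suc j)"
proof -
  have "left_end \<longlonglongrightarrow> 1" using sums_1 by (simp add: sums_def left_end_def[abs_def])
  then have "eventually (\<lambda>j. x < left_end j) sequentially"
    using assms(2) by (rule order_tendstoD)
  then have ex: "\<exists>j. x < left_end j"
    by (auto simp: eventually_sequentially)
  define j where "j = (LEAST j. x < left_end j)"
  have j: "x < left_end j" using ex unfolding j_def by (rule LeastI_ex)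
  moreover have "left_end 0 = 0" by (simp add: left_end_def)
  ultimately have "j \<noteq> 0" using assms(1) by (metis not_less)
  then obtain i where i: "j = Suc i" by (metis not0_implies_Suc)
  then have "\<not> x < left_end i" unfolding j_def by (intro not_less_Least) auto
  then show ?thesis using i j by (auto simp: not_less)
qed

text \<open>The value 0 outside \<open>{0..<1}\<close> replaces an unspecified \<open>THE\<close>;
  within the unit interval this concerns only the point 1.\<close>

definition cell_index :: "real \<Rightarrow> nat" where
  "cell_index x = (if x \<in> {0..<1} then part_index a x else 0)"

definition cell_pos :: "real \<Rightarrow> real" where
  "cell_pos x = (if x \<in> {0..<1} then (x - left_end (cell_index x)) / a (cell_index x) else 0)"

lemma cell_index_bounds:
  assumes "x \<in> {0..<1}"
  shows "left_end (cell_index x) \<le> x" "x < left_end (Suc (cell_index x))"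
  using ex_part[of x] part_index_eq[of _ x] assms by (auto simp: cell_index_def)

lemma cell_pos_range: "cell_pos x \<in> {0..<1}"
  using cell_index_bounds[of x] pos[of "cell_index x"]
  by (auto simp: cell_pos_def left_end_Suc field_simps)

lemma measurable_cell_index [measurable]: "cell_index \<in> unit_lborel \<rightarrow>\<^sub>M count_space UNIV"
proof -
  \<comment> \<open>The \<open>THE\<close> is traded for a \<open>LEAST\<close> over Borel
    conditions, a form in which measurability is automatic.\<close>
  have "cell_index x = (if 0 \<le> x \<and> x < 1 then LEAST j. x < left_end (Suc j) else 0)" for x
  proof (cases "x \<in> {0..<1}")
    case True
    have "(LEAST j. x < left_end (Suc j)) = cell_index x"
    proof (rule Least_equality)
      show "x < left_end (Suc (cell_index x))" using cell_index_bounds[OF True] by simp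
      fix j assume "x < left_end (Suc j)"
      then have "left_end (cell_index x) < left_end (Suc j)"
        using cell_index_bounds(1)[OF True] by simp
      then show "cell_index x \<le> j"
        using strict_mono_less[OF strict_mono_left_end] by simp
    qed
    then show ?thesis using True by simp
  qed (auto simp: cell_index_def)
  then have eq: "cell_index = (\<lambda>x. if 0 \<le> x \<and> x < 1 then LEAST j. x < left_end (Suc j) else 0)"
    by (rule ext)
  show ?thesis unfolding eq by measurable
qed

lemma measurable_cell_pos [measurable]: "cell_pos \<in> unit_lborel \<rightarrow>\<^sub>M unit_lborel"
proof -
  have [measurable]: "(\<lambda>x. left_end (cell_index x)) \<in> borel_measurable unit_lborel"
    "(\<lambda>x. a (cell_index x)) \<in> borel_measurable unit_lborel"
    by (rule measurable_compose[OF measurable_cell_index], simp)+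
  have "(\<lambda>x. if 0 \<le> x \<and> x < 1 then (x - left_end (cell_index x)) / a (cell_index x) else 0)
      \<in> borel_measurable unit_lborel"
    by measurable
  also have "(\<lambda>x. if 0 \<le> x \<and> x < 1 then (x - left_end (cell_index x)) / a (cell_index x) else 0) = cell_pos"
    by (auto simp: cell_pos_def fun_eq_iff)
  finally have "cell_pos \<in> unit_lborel \<rightarrow>\<^sub>M lborel" by simp
  moreover have "cell_pos x \<in> {0..1}" for x using cell_pos_range[of x] by auto
  ultimately show ?thesis
    by (subst (2) unit_lborel_def, intro measurable_restrict_space2) auto
qed

text \<open>The affine map from the unit interval to cell \<open>j\<close> scales measure by
  \<open>a j\<close> and inverts \<open>cell_pos\<close> there.\<close>

lemma emeasure_cell:
  assumes B: "B \<in> sets unit_lborel"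
  shows "emeasure unit_lborel {x \<in> space unit_lborel. cell_index x = j \<and> cell_pos x \<in> B}
    = ennreal (a j) * emeasure unit_lborel B"
proof -
  let ?S = "{x \<in> space unit_lborel. cell_index x = j \<and> cell_pos x \<in> B}"
  \<comment> \<open>The point 1 has only default values of index and position, and position 1 would
    land in the next cell. Both are discarded as null sets.\<close>
  define T where "T = ?S - {1}"
  have S: "?S \<in> sets unit_lborel" using B by measurable
  have null: "{1 :: real} \<in> null_sets lborel" by (simp add: null_sets_def)
  have SB: "?S \<in> sets borel" "B \<in> sets borel"
    using S B by (auto simp: unit_lborel_def sets_restrict_space_iff)
  have [measurable]: "T \<in> sets borel" unfolding T_def using SB by auto
  have iff: "left_end j + a j * y \<in> T \<longleftrightarrow> y \<in> B - {1}" for y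
  proof
    assume T: "left_end j + a j * y \<in> T"
    then have x: "left_end j + a j * y \<in> {0..<1}" "cell_index (left_end j + a j * y) = j"
      by (auto simp: T_def)
    then have "cell_pos (left_end j + a j * y) = y" using pos[of j] by (simp add: cell_pos_def)
    then show "y \<in> B - {1}" using T cell_pos_range[of "left_end j + a j * y"] by (auto simp: T_def)
  next
    assume y: "y \<in> B - {1}"
    then have y01: "0 \<le> y" "y < 1" using sets.sets_into_space[OF B] by force+
    have "left_end j \<le> left_end j + a j * y" "left_end j + a j * y < left_end (Suc j)"
      using y01 pos[of j] by (auto simp: left_end_Suc mult_less_cancel_left1)
    then have "part_index a (left_end j + a j * y) = j" by (rule part_index_eq)
    moreover have "left_end j + a j * y \<in> {0..<1}"
      using left_end_nonneg[of j] left_end_less_1[of "Suc j"] \<open>left_end j \<le> _\<close> \<open>_ < left_end (Suc j)\<close>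
      by auto
    ultimately show "left_end j + a j * y \<in> T"
      using y pos[of j] by (auto simp: T_def cell_index_def cell_pos_def)
  qed
  have "emeasure unit_lborel ?S = emeasure lborel T"
    using S SB null unfolding T_def by (simp add: emeasure_unit_lborel emeasure_Diff_null_set)
  also have "\<dots> = (\<integral>\<^sup>+x. indicator T x \<partial>lborel)" by simp
  also have "\<dots> = ennreal \<bar>a j\<bar> * (\<integral>\<^sup>+y. indicator T (left_end j + a j * y) \<partial>lborel)"
    using pos[of j] by (intro nn_integral_real_affine) auto
  also have "(\<integral>\<^sup>+y. indicator T (left_end j + a j * y) \<partial>lborel) = (\<integral>\<^sup>+y. indicator (B - {1}) y \<partial>lborel)"
    using iff by (intro nn_integral_cong) (simp add: indicator_def)
  also have "\<dots> = emeasure lborel (B - {1})" using SB by (intro nn_integral_indicator) auto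
  also have "\<dots> = emeasure unit_lborel B"
    using SB null B by (simp add: emeasure_unit_lborel emeasure_Diff_null_set)
  finally show ?thesis using pos[of j] by simp
qed

definition index_dist :: "nat measure" where
  "index_dist = distr unit_lborel (count_space UNIV) cell_index"

lemma sets_index_dist [simp, measurable_cong]: "sets index_dist = sets (count_space UNIV)"
  by (simp add: index_dist_def)

lemma space_index_dist [simp]: "space index_dist = UNIV"
  by (simp add: index_dist_def)

lemma prob_space_index_dist: "prob_space index_dist"
  unfolding index_dist_def by (intro unit_lborel.prob_space_distr) measurable

lemma emeasure_index_dist: "emeasure index_dist {j} = ennreal (a j)"
proof -
  have "cell_index -` {j} \<inter> space unit_lborel
      = {x \<in> space unit_lborel. cell_index x = j \<and> cell_pos x \<in> {0..1}}"
  proof -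
    have "cell_pos x \<in> {0..1}" for x using cell_pos_range[of x] by auto
    then show ?thesis by blast
  qed
  moreover have "{0..1} \<in> sets unit_lborel" using sets.top[of unit_lborel] by simp
  moreover have "emeasure unit_lborel {0..1} = 1" using unit_lborel.emeasure_space_1 by simp
  ultimately show ?thesis
    unfolding index_dist_def using emeasure_cell[of "{0..1}" j]
    by (simp add: emeasure_distr)
qed

text \<open>The cell and the position of a uniform point are independent, and the position is again
  uniform: \<open>emeasure_cell\<close> shows this on each single cell, and the cells in
  \<open>A\<close> are countably many.\<close>

lemma distr_cell:
  "distr unit_lborel (index_dist \<Otimes>\<^sub>M unit_lborel) (\<lambda>x. (cell_index x, cell_pos x))
    = index_dist \<Otimes>\<^sub>M unit_lborel"
proof (rule pair_measure_eqI[symmetric])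
  interpret index_dist: prob_space index_dist by (rule prob_space_index_dist)
  show "sigma_finite_measure index_dist" "sigma_finite_measure unit_lborel" by unfold_locales
  fix A B assume A: "A \<in> sets index_dist" and B: "B \<in> sets unit_lborel"
  let ?S = "\<lambda>j. {x \<in> space unit_lborel. cell_index x = j \<and> cell_pos x \<in> B}"
  have "(\<lambda>x. (cell_index x, cell_pos x)) -` (A \<times> B) \<inter> space unit_lborel = (\<Union>j\<in>A. ?S j)" by auto
  then have "emeasure (distr unit_lborel (index_dist \<Otimes>\<^sub>M unit_lborel) (\<lambda>x. (cell_index x, cell_pos x))) (A \<times> B)
      = emeasure unit_lborel (\<Union>j\<in>A. ?S j)"
    using A B by (subst emeasure_distr) (auto intro!: measurable_Pair pair_measureI)
  also have "\<dots> = (\<integral>\<^sup>+j. emeasure unit_lborel (?S j) \<partial>count_space A)"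
  proof (rule emeasure_UN_countable)
    show "?S j \<in> sets unit_lborel" for j using B by measurable
  qed (auto simp: disjoint_family_on_def)
  also have "\<dots> = (\<integral>\<^sup>+j. emeasure index_dist {j} * emeasure unit_lborel B \<partial>count_space A)"
    by (simp only: emeasure_cell[OF B] emeasure_index_dist)
  also have "\<dots> = (\<integral>\<^sup>+j. emeasure index_dist {j} \<partial>count_space A) * emeasure unit_lborel B"
    by (rule nn_integral_multc) simp
  also have "\<dots> = emeasure index_dist A * emeasure unit_lborel B"
    by (subst emeasure_countable_singleton[of A]) auto
  finally show "emeasure index_dist A * emeasure unit_lborel B
      = emeasure (distr unit_lborel (index_dist \<Otimes>\<^sub>M unit_lborel) (\<lambda>x. (cell_index x, cell_pos x))) (A \<times> B)"
    by simp
qed simp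

lemma distr_cell_pos: "distr unit_lborel unit_lborel cell_pos = unit_lborel"
proof (rule measure_eqI)
  fix B assume "B \<in> sets (distr unit_lborel unit_lborel cell_pos)"
  then have B: "B \<in> sets unit_lborel" by simp
  interpret index_dist: prob_space index_dist by (rule prob_space_index_dist)
  have "emeasure (index_dist \<Otimes>\<^sub>M unit_lborel) (UNIV \<times> B) = emeasure unit_lborel B"
    using B index_dist.emeasure_space_1 by (simp add: unit_lborel.emeasure_pair_measure_Times)
  moreover have "emeasure (distr unit_lborel (index_dist \<Otimes>\<^sub>M unit_lborel) (\<lambda>x. (cell_index x, cell_pos x))) (UNIV \<times> B)
      = emeasure unit_lborel (cell_pos -` B \<inter> space unit_lborel)"
    using B by (subst emeasure_distr) (auto intro!: measurable_Pair pair_measureI arg_cong2[where f = emeasure])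
  ultimately show "emeasure (distr unit_lborel unit_lborel cell_pos) B = emeasure unit_lborel B"
    using B by (simp add: distr_cell emeasure_distr)
qed simp

text \<open>Expresses \<open>graphon_to_seq a\<close> through the measurable maps
  \<open>cell_index\<close> and \<open>cell_pos\<close>, which makes it Borel for a Borel
  \<open>V\<close>.\<close>

definition cell_kernel :: "(real \<Rightarrow> real \<Rightarrow> real) \<Rightarrow> real \<Rightarrow> real \<Rightarrow> real" where
  "cell_kernel V x y = (if cell_index x = cell_index y then V (cell_pos x) (cell_pos y) else 0)"

lemma graphon_to_seq_eq_cell_kernel:
  assumes "x \<in> {0..<1}" "y \<in> {0..<1}"
  shows "graphon_to_seq a W x y = cell_kernel W x y"
  using assms by (auto simp: graphon_to_seq_def cell_kernel_def cell_pos_def cell_index_def left_end_def Let_def)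

lemma borel_kernel_cell_kernel:
  assumes "borel_kernel V"
  shows "borel_kernel (cell_kernel V)"
proof
  interpret borel_kernel V by fact
  have "(\<lambda>p. (cell_pos (fst p), cell_pos (snd p))) \<in> unit_lborel \<Otimes>\<^sub>M unit_lborel \<rightarrow>\<^sub>M unit_lborel \<Otimes>\<^sub>M unit_lborel"
    by measurable
  from measurable_compose[OF this V_borel]
  have V: "(\<lambda>p. V (cell_pos (fst p)) (cell_pos (snd p))) \<in> borel_measurable (unit_lborel \<Otimes>\<^sub>M unit_lborel)"
    by simp
  show "(\<lambda>p. cell_kernel V (fst p) (snd p)) \<in> borel_measurable (unit_lborel \<Otimes>\<^sub>M unit_lborel)"
    unfolding cell_kernel_def
    by (intro measurable_If[OF V] sets_Collect_nat_eq measurable_compose[OF _ measurable_cell_index]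
        measurable_fst measurable_snd) simp
  show "0 \<le> cell_kernel V x y \<and> cell_kernel V x y \<le> 1" for x y
    using V_range by (simp add: cell_kernel_def)
qed

lemma distr_unit_pair_snd: "distr (unit_lborel \<Otimes>\<^sub>M unit_lborel) unit_lborel snd = unit_lborel"
proof (rule measure_eqI)
  fix A assume "A \<in> sets (distr (unit_lborel \<Otimes>\<^sub>M unit_lborel) unit_lborel snd)"
  then have A: "A \<in> sets unit_lborel" by simp
  have "snd -` A \<inter> space (unit_lborel \<Otimes>\<^sub>M unit_lborel) = space unit_lborel \<times> A"
    using sets.sets_into_space[OF A] by (auto simp: space_pair_measure)
  then show "emeasure (distr (unit_lborel \<Otimes>\<^sub>M unit_lborel) unit_lborel snd) A = emeasure unit_lborel A"
    using A unit_lborel.emeasure_pair_measure_Times[OF sets.top[of unit_lborel] A] unit_lborel.emeasure_space_1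
    by (simp add: emeasure_distr del: space_unit_lborel)
qed simp

lemma AE_unit_pair_less_1:
  "AE p in unit_lborel \<Otimes>\<^sub>M unit_lborel. fst p \<in> {0..<1} \<and> snd p \<in> {0..<1}"
proof -
  have 1: "AE x in unit_lborel. x \<in> {0..<1}"
  proof -
    have "AE x in lborel. x \<noteq> (1 :: real)" by (rule AE_lborel_singleton)
    then show ?thesis
      unfolding unit_lborel_def by (subst AE_restrict_space_iff) (auto elim: eventually_mono)
  qed
  have "AE p in unit_lborel \<Otimes>\<^sub>M unit_lborel. fst p \<in> {0..<1}"
    by (rule AE_distrD[OF measurable_fst]) (simp only: unit_lborel.distr_pair_fst 1)
  moreover have "AE p in unit_lborel \<Otimes>\<^sub>M unit_lborel. snd p \<in> {0..<1}"
    by (rule AE_distrD[OF measurable_snd]) (simp only: distr_unit_pair_snd 1)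
  ultimately show ?thesis by eventually_elim simp
qed

text \<open>Applying \<open>cell_pos\<close> to both coordinates preserves the measure of the
  square, so the null set where \<open>W\<close> and \<open>V\<close> differ has a null
  preimage.\<close>

lemma AE_graphon_to_seq:
  assumes ae: "AE p in unit_lborel \<Otimes>\<^sub>M unit_lborel. W (fst p) (snd p) = V (fst p) (snd p)"
  shows "AE p in unit_lborel \<Otimes>\<^sub>M unit_lborel.
    graphon_to_seq a W (fst p) (snd p) = cell_kernel V (fst p) (snd p)"
proof -
  let ?g = "\<lambda>p. (cell_pos (fst p), cell_pos (snd p))"
  have "distr (unit_lborel \<Otimes>\<^sub>M unit_lborel) (unit_lborel \<Otimes>\<^sub>M unit_lborel) ?g
      = unit_lborel \<Otimes>\<^sub>M unit_lborel"
    using pair_measure_distr[OF measurable_cell_pos measurable_cell_pos]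
    by (simp add: distr_cell_pos unit_lborel.sigma_finite_measure_axioms case_prod_unfold)
  then have "AE p in distr (unit_lborel \<Otimes>\<^sub>M unit_lborel) (unit_lborel \<Otimes>\<^sub>M unit_lborel) ?g.
      W (fst p) (snd p) = V (fst p) (snd p)"
    by (rule ssubst) (rule ae)
  moreover have "?g \<in> unit_lborel \<Otimes>\<^sub>M unit_lborel \<rightarrow>\<^sub>M unit_lborel \<Otimes>\<^sub>M unit_lborel"
    by measurable
  ultimately have "AE p in unit_lborel \<Otimes>\<^sub>M unit_lborel. W (fst (?g p)) (snd (?g p)) = V (fst (?g p)) (snd (?g p))"
    by (rule AE_distrD[rotated])
  with AE_unit_pair_less_1 show ?thesis
  proof eventually_elim
    case (elim p)
    then show ?case
      by (simp add: graphon_to_seq_eq_cell_kernel) (simp add: cell_kernel_def case_prod_unfold)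
  qed
qed

lemma graphon_graphon_to_seq:
  assumes W: "graphon W"
  shows "graphon (graphon_to_seq a W)"
  unfolding graphon_def
proof (intro conjI ballI)
  obtain V where V: "borel_kernel V"
    "AE p in unit_lborel \<Otimes>\<^sub>M unit_lborel. W (fst p) (snd p) = V (fst p) (snd p)"
    using graphon_ex_borel_kernel[OF W] .
  show "(\<lambda>(x, y). graphon_to_seq a W x y) \<in> borel_measurable (lebesgue_on ({0..1} \<times> {0..1}))"
    by (rule borel_kernel.borel_measurable_lebesgue_on_unit_square
        [OF borel_kernel_cell_kernel[OF V(1)] AE_graphon_to_seq[OF V(2)]])
  fix x y :: real
  have W': "W (cell_pos x) (cell_pos y) \<in> {0..1}" "W (cell_pos x) (cell_pos y) = W (cell_pos y) (cell_pos x)"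
    using W cell_pos_range[of x] cell_pos_range[of y] by (auto simp: graphon_def)
  show "graphon_to_seq a W x y \<in> {0..1}"
    using W'(1) graphon_to_seq_eq_cell_kernel[of x y W]
    by (cases "x \<in> {0..<1} \<and> y \<in> {0..<1}") (auto simp: cell_kernel_def graphon_to_seq_def[of _ _ x y])
  show "graphon_to_seq a W x y = graphon_to_seq a W y x"
  proof (cases "x \<in> {0..<1} \<and> y \<in> {0..<1}")
    case True
    then show ?thesis using W'(2) by (simp only: graphon_to_seq_eq_cell_kernel cell_kernel_def) metis
  next
    case False
    then show ?thesis unfolding graphon_to_seq_def by argo
  qed
qed

end

section \<open>Densities of \<open>graphon_to_seq a W\<close> in terms of power sums\<close>

text \<open>Sampling \<open>k\<close> uniform points amounts to sampling \<open>k\<close> cells and,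
  independently, \<open>k\<close> uniform positions. The cells decide whether the weight survives,
  and the positions give the weight of \<open>F\<close> in \<open>V\<close>.\<close>

lemma (in unit_partition) hom_density_cell_kernel:
  assumes V: "borel_kernel V" and F: "F \<subseteq> vertex_pairs k"
  shows "hom_density k F (cell_kernel V) = label_agreement_prob index_dist k F * hom_density k F V"
proof -
  interpret borel_kernel V by fact
  interpret Q: prob_space index_dist by (rule prob_space_index_dist)
  let ?Q = index_dist
  let ?P = unit_lborel
  let ?PQ = "PiM {..<k} (\<lambda>_. ?Q)"
  let ?PP = "PiM {..<k} (\<lambda>_. ?P)"
  let ?PN = "PiM {..<k} (\<lambda>_. ?Q \<Otimes>\<^sub>M ?P)"
  interpret PQ: prob_space ?PQ by (rule prob_space_PiM) (rule Q.prob_space_axioms)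
  interpret PP: prob_space ?PP by (rule prob_space_PiM) (rule unit_lborel.prob_space_axioms)
  interpret pair_prob_space ?PQ ?PP by unfold_locales
  define G where "G = (\<lambda>z :: nat \<Rightarrow> nat \<times> real. \<Prod>e\<in>F.
    if fst (z (fst e)) = fst (z (snd e)) then V (snd (z (fst e))) (snd (z (snd e))) else 0)"
  define h where "h = (\<lambda>y. \<Prod>e\<in>F. edge_weight V y e)"
  define A where "A = {x \<in> space ?PQ. \<forall>e\<in>F. x (fst e) = x (snd e)}"
  have Fk: "fst e < k" "snd e < k" if "e \<in> F" for e
    using that F by (auto simp: vertex_pairs_def)
  have mQ: "(N \<rightarrow>\<^sub>M ?Q) = (N \<rightarrow>\<^sub>M count_space UNIV)" for N :: "'z measure"
    by (rule measurable_cong_sets) simp_all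
  have finF: "finite F" using F by (rule finite_sub_vertex_pairs)
  have G [measurable]: "G \<in> borel_measurable ?PN"
    unfolding G_def
  proof (rule borel_measurable_prod)
    fix e assume e: "e \<in> F"
    have c: "(\<lambda>z. z (fst e)) \<in> ?PN \<rightarrow>\<^sub>M ?Q \<Otimes>\<^sub>M ?P" "(\<lambda>z. z (snd e)) \<in> ?PN \<rightarrow>\<^sub>M ?Q \<Otimes>\<^sub>M ?P"
      using Fk[OF e] by (auto intro!: measurable_component_singleton)
    have "(\<lambda>z. (snd (z (fst e)), snd (z (snd e)))) \<in> ?PN \<rightarrow>\<^sub>M ?P \<Otimes>\<^sub>M ?P"
      by (intro measurable_Pair measurable_compose[OF c(1) measurable_snd] measurable_compose[OF c(2) measurable_snd])
    from measurable_compose[OF this V_borel]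
    have 1: "(\<lambda>z. V (snd (z (fst e))) (snd (z (snd e)))) \<in> borel_measurable ?PN" by simp
    have "(\<lambda>z. fst (z (fst e))) \<in> ?PN \<rightarrow>\<^sub>M count_space UNIV" "(\<lambda>z. fst (z (snd e))) \<in> ?PN \<rightarrow>\<^sub>M count_space UNIV"
      using measurable_compose[OF c(1) measurable_fst] measurable_compose[OF c(2) measurable_fst]
      by (simp_all add: mQ)
    then show "(\<lambda>z. if fst (z (fst e)) = fst (z (snd e)) then V (snd (z (fst e))) (snd (z (snd e))) else 0)
        \<in> borel_measurable ?PN"
      by (intro measurable_If[OF 1] sets_Collect_nat_eq) auto
  qed
  have A: "A \<in> sets ?PQ"
    unfolding A_def
  proof (rule sets.sets_Collect_finite_All[OF _ finF])
    fix e assume e: "e \<in> F"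
    have "(\<lambda>x. x (fst e)) \<in> ?PQ \<rightarrow>\<^sub>M ?Q" "(\<lambda>x. x (snd e)) \<in> ?PQ \<rightarrow>\<^sub>M ?Q"
      using Fk[OF e] by (auto intro!: measurable_component_singleton)
    then show "{x \<in> space ?PQ. x (fst e) = x (snd e)} \<in> sets ?PQ"
      by (intro sets_Collect_nat_eq) (simp_all add: mQ)
  qed
  have h: "h \<in> borel_measurable ?PP" "integrable ?PP h"
    unfolding h_def using measurable_prod_edge_weight[OF F] integrable_prod_edge_weight[OF F]
    by (simp_all add: sample_points_eq)
  let ?c = "\<lambda>x. \<lambda>i\<in>{..<k}. (cell_index (x i), cell_pos (x i))"
  let ?z = "\<lambda>(x, y). \<lambda>i\<in>{..<k}. (x i, y i)"
  have cm: "(\<lambda>x. (cell_index x, cell_pos x)) \<in> ?P \<rightarrow>\<^sub>M ?Q \<Otimes>\<^sub>M ?P"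
    using measurable_cell_index by (intro measurable_Pair) (simp_all add: mQ)
  have c: "?c \<in> ?PP \<rightarrow>\<^sub>M ?PN"
    by (intro measurable_restrict measurable_compose[OF _ cm] measurable_component_singleton)
  have z: "?z \<in> ?PQ \<Otimes>\<^sub>M ?PP \<rightarrow>\<^sub>M ?PN" by measurable
  have "hom_density k F (cell_kernel V) = (LINT x | ?PP. G (?c x))"
    unfolding hom_density_def sample_points_eq G_def edge_weight_def cell_kernel_def
    using Fk by (intro Bochner_Integration.integral_cong prod.cong) auto
  also have "\<dots> = integral\<^sup>L (distr ?PP ?PN ?c) G"
    by (rule integral_distr[OF c G, symmetric])
  also have "distr ?PP ?PN ?c = ?PN"
    using distr_PiM_map[OF unit_lborel.prob_space_axioms cm finite_lessThan, of k] by (simp only: distr_cell)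
  also have "integral\<^sup>L ?PN G = integral\<^sup>L (distr (?PQ \<Otimes>\<^sub>M ?PP) ?PN ?z) G"
    by (simp only: distr_pair_PiM_zip[OF Q.prob_space_axioms unit_lborel.prob_space_axioms finite_lessThan])
  also have "\<dots> = (LINT p | (?PQ \<Otimes>\<^sub>M ?PP). G (?z p))"
    by (rule integral_distr[OF z G])
  \<comment> \<open>A single edge between different cells makes the product vanish; otherwise every
    factor is an edge weight of \<open>V\<close> at the positions.\<close>
  also have "\<dots> = (LINT p | (?PQ \<Otimes>\<^sub>M ?PP). indicator A (fst p) * h (snd p))"
  proof (rule Bochner_Integration.integral_cong[OF refl])
    fix p assume p: "p \<in> space (?PQ \<Otimes>\<^sub>M ?PP)"
    obtain x y where xy: "p = (x, y)" by (cases p)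
    have x: "x \<in> space ?PQ" using p by (simp add: xy space_pair_measure)
    have "G (?z p) = (\<Prod>e\<in>F. if x (fst e) = x (snd e) then edge_weight V y e else 0)"
      unfolding G_def edge_weight_def using Fk by (intro prod.cong) (auto simp: xy)
    also have "\<dots> = indicator A x * h y"
    proof (cases "\<forall>e\<in>F. x (fst e) = x (snd e)")
      case True
      then show ?thesis using x by (simp add: A_def h_def)
    next
      case False
      then obtain e where "e \<in> F" "x (fst e) \<noteq> x (snd e)" by blast
      then have "(\<Prod>e\<in>F. if x (fst e) = x (snd e) then edge_weight V y e else 0) = 0"
        using finF by (intro prod_zero) auto
      moreover have "x \<notin> A" using False by (simp add: A_def)
      ultimately show ?thesis by simp
    qed
    finally show "G (?z p) = indicator A (fst p) * h (snd p)" by (simp add: xy)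
  qed
  also have "\<dots> = (LINT x | ?PQ. LINT y | ?PP. indicator A x * h y)"
  proof -
    have h01: "0 \<le> h y" "h y \<le> 1" for y
      unfolding h_def by (rule prod_edge_weight_range)+
    have "integrable (?PQ \<Otimes>\<^sub>M ?PP) (\<lambda>p. indicator A (fst p) * h (snd p))"
    proof (rule P.integrable_const_bound[where B = 1])
      show "AE p in (?PQ \<Otimes>\<^sub>M ?PP). norm (indicator A (fst p) * h (snd p)) \<le> 1"
        using h01 by (intro AE_I2) (simp add: indicator_def)
      show "(\<lambda>p. indicator A (fst p) * h (snd p)) \<in> borel_measurable (?PQ \<Otimes>\<^sub>M ?PP)"
        using A h(1) by measurable
    qed
    from integral_fst'[OF this] show ?thesis by simp
  qed
  also have "\<dots> = measure ?PQ A * integral\<^sup>L ?PP h"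
    using A by simp
  finally show ?thesis
    by (simp add: label_agreement_prob_def A_def h_def hom_density_def sample_points_eq)
qed

definition power_sum :: "(nat \<Rightarrow> real) \<Rightarrow> nat \<Rightarrow> real" where
  "power_sum a l = (\<Sum>i. a i ^ l)"

lemma (in unit_partition) summable_power:
  assumes "1 \<le> l"
  shows "summable (\<lambda>i. a i ^ l)"
proof (rule summable_comparison_test')
  show "summable a" using sums_1 by (rule sums_summable)
  fix i
  have "a i \<le> 1" using left_end_less_1[of "Suc i"] left_end_nonneg[of i] by (simp add: left_end_Suc)
  then show "norm (a i ^ l) \<le> a i"
    using pos[of i] power_decreasing[of 1 l "a i"] assms by simp
qed

lemma (in unit_partition) suminf_index_dist_power:
  assumes "1 \<le> l"
  shows "(\<Sum>m. emeasure index_dist {m} ^ l) = ennreal (power_sum a l)"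
proof -
  have "(\<Sum>m. emeasure index_dist {m} ^ l) = (\<Sum>m. ennreal (a m ^ l))"
    using pos by (simp add: emeasure_index_dist ennreal_power less_imp_le)
  also have "\<dots> = ennreal (power_sum a l)"
    unfolding power_sum_def
    using pos by (intro suminf_ennreal2 summable_power assms) (simp add: less_imp_le)
  finally show ?thesis .
qed

lemma (in unit_partition) graph_density_graphon_to_seq:
  assumes V: "borel_kernel V"
    and ae: "AE p in unit_lborel \<Otimes>\<^sub>M unit_lborel. W (fst p) (snd p) = V (fst p) (snd p)"
    and k: "k = card (fst H)"
  shows "graph_density H (graphon_to_seq a W) = (\<Sum>E\<in>iso_edge_sets k H.
    \<Sum>X\<in>Pow (vertex_pairs k - E). (-1) ^ card X *
      (label_agreement_prob index_dist k (E \<union> X) * hom_density k (E \<union> X) V))"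
proof -
  interpret V: borel_kernel V by fact
  interpret C: borel_kernel "cell_kernel V" by (rule borel_kernel_cell_kernel) fact
  have "graph_density H (graphon_to_seq a W) = (\<Sum>E\<in>iso_edge_sets k H. induced_density k E (cell_kernel V))"
    by (rule C.graph_density_eq[OF AE_graphon_to_seq[OF ae] k])
  also have "\<dots> = (\<Sum>E\<in>iso_edge_sets k H. \<Sum>X\<in>Pow (vertex_pairs k - E). (-1) ^ card X *
      (label_agreement_prob index_dist k (E \<union> X) * hom_density k (E \<union> X) V))"
  proof (rule sum.cong[OF refl])
    fix E assume "E \<in> iso_edge_sets k H"
    then have E: "E \<subseteq> vertex_pairs k" by (simp add: iso_edge_sets_def)
    have "hom_density k (E \<union> X) (cell_kernel V)
        = label_agreement_prob index_dist k (E \<union> X) * hom_density k (E \<union> X) V"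
      if "X \<in> Pow (vertex_pairs k - E)" for X
      using that E by (intro hom_density_cell_kernel V) auto
    then show "induced_density k E (cell_kernel V) = (\<Sum>X\<in>Pow (vertex_pairs k - E). (-1) ^ card X *
      (label_agreement_prob index_dist k (E \<union> X) * hom_density k (E \<union> X) V))"
      unfolding C.induced_density_eq_hom_density[OF E] by (intro sum.cong refl) simp
  qed
  finally show ?thesis .
qed

text \<open>The sequence enters only through the label agreement probabilities of graphs on
  \<open>card (fst H)\<close> vertices, hence through the power sums up to that exponent.\<close>

lemma graph_density_graphon_to_seq_cong:
  assumes a: "unit_partition a" and a': "unit_partition a'" and W: "graphon W"
    and eq: "\<And>l. 1 \<le> l \<Longrightarrow> l \<le> card (fst H) \<Longrightarrow> power_sum a l = power_sum a' l"
  shows "graph_density H (graphon_to_seq a W) = graph_density H (graphon_to_seq a' W)"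
proof -
  interpret a: unit_partition a by fact
  interpret a': unit_partition a' by fact
  obtain V where V: "borel_kernel V"
    "AE p in unit_lborel \<Otimes>\<^sub>M unit_lborel. W (fst p) (snd p) = V (fst p) (snd p)"
    using graphon_ex_borel_kernel[OF W] .
  define k where "k = card (fst H)"
  have "label_agreement_prob a.index_dist k F = label_agreement_prob a'.index_dist k F"
    if "F \<subseteq> vertex_pairs k" for F
    using that a.prob_space_index_dist a'.prob_space_index_dist eq
    by (intro label_agreement_prob_cong)
      (simp_all add: a.suminf_index_dist_power a'.suminf_index_dist_power k_def)
  then have "label_agreement_prob a.index_dist k (E \<union> X) = label_agreement_prob a'.index_dist k (E \<union> X)"
    if "E \<in> iso_edge_sets k H" "X \<in> Pow (vertex_pairs k - E)" for E X
    using that by (simp add: iso_edge_sets_def subset_iff)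
  then show ?thesis
    unfolding a.graph_density_graphon_to_seq[OF V k_def] a'.graph_density_graphon_to_seq[OF V k_def]
    by (intro sum.cong refl) simp
qed

section \<open>Connected graphs and stars\<close>

text \<open>Composed with the inverse of the isomorphism, a labelling that agrees along
  \<open>E\<close> agrees along \<open>E0\<close> and is therefore constant.\<close>

lemma iso_edge_sets_connected:
  assumes E: "E \<in> iso_edge_sets n (edge_graph n E0)" and E0: "E0 \<subseteq> vertex_pairs n" "connected_pairs n E0"
  shows "connected_pairs n E"
  unfolding connected_pairs_def
proof (intro allI impI)
  fix x :: "nat \<Rightarrow> nat" and i j assume x: "\<forall>e\<in>E. x (fst e) = x (snd e)" and ij: "i < n" "j < n"
  obtain f where f: "bij_betw f {..<n} {..<n}"
    and fE: "\<And>u v. u < n \<Longrightarrow> v < n \<Longrightarrow> {u, v} \<in> (\<lambda>(i, j). {i, j}) ` E \<longleftrightarrow> {f u, f v} \<in> (\<lambda>(i, j). {i, j}) ` E0"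
    using E unfolding iso_edge_sets_def graph_iso_def edge_graph_def by auto
  define g where "g = inv_into {..<n} f"
  have g: "g i < n" "f (g i) = i" if "i < n" for i
  proof -
    have i: "i \<in> f ` {..<n}" using that f by (simp add: bij_betw_def)
    show "g i < n" using inv_into_into[OF i] by (simp add: g_def)
    show "f (g i) = i" using f_inv_into_f[OF i] by (simp add: g_def)
  qed
  have gf: "g (f i) = i" if "i < n" for i
    using that f by (simp add: g_def bij_betw_def)
  have "(x \<circ> g) (fst e) = (x \<circ> g) (snd e)" if e: "e \<in> E0" for e
  proof -
    have lt: "fst e < n" "snd e < n" using e E0(1) by (auto simp: vertex_pairs_def)
    have "{fst e, snd e} \<in> (\<lambda>(i, j). {i, j}) ` E0" using e by (force simp: case_prod_unfold)
    then have "{g (fst e), g (snd e)} \<in> (\<lambda>(i, j). {i, j}) ` E"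
      using fE[of "g (fst e)" "g (snd e)"] g lt by simp
    then obtain d where "d \<in> E" "{g (fst e), g (snd e)} = {fst d, snd d}"
      by (auto simp: case_prod_unfold)
    then show ?thesis using x by (auto simp: doubleton_eq_iff)
  qed
  then have "\<forall>i<n. \<forall>j<n. (x \<circ> g) i = (x \<circ> g) j"
    using E0(2) unfolding connected_pairs_def by blast
  moreover have "f i < n" "f j < n" using f ij by (auto simp: bij_betw_def)
  ultimately have "(x \<circ> g) (f i) = (x \<circ> g) (f j)" by blast
  then show "x i = x j" using gf ij by simp
qed

lemma connected_pairs_mono: "connected_pairs n E \<Longrightarrow> E \<subseteq> E' \<Longrightarrow> connected_pairs n E'"
  unfolding connected_pairs_def by blast

text \<open>Every edge set in the inclusion-exclusion formula contains a connected one, so all label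
  agreement probabilities equal the same power sum, which factors out.\<close>

lemma (in unit_partition) graph_density_graphon_to_seq_connected:
  assumes V: "borel_kernel V"
    and ae: "AE p in unit_lborel \<Otimes>\<^sub>M unit_lborel. W (fst p) (snd p) = V (fst p) (snd p)"
    and E0: "E0 \<subseteq> vertex_pairs n" "connected_pairs n E0" and "0 < n"
  shows "graph_density (edge_graph n E0) (graphon_to_seq a W)
    = power_sum a n * graph_density (edge_graph n E0) W"
proof -
  interpret V: borel_kernel V by fact
  have n: "n = card (fst (edge_graph n E0))" by (simp add: edge_graph_def)
  have ps: "0 \<le> power_sum a n"
    unfolding power_sum_def using pos \<open>0 < n\<close> by (intro suminf_nonneg summable_power) (auto simp: less_imp_le)
  have "label_agreement_prob index_dist n (E \<union> X) = power_sum a n"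
    if E: "E \<in> iso_edge_sets n (edge_graph n E0)" and X: "X \<in> Pow (vertex_pairs n - E)" for E X
  proof -
    have "connected_pairs n (E \<union> X)"
      using iso_edge_sets_connected[OF E E0] by (rule connected_pairs_mono) auto
    moreover have "E \<union> X \<subseteq> vertex_pairs n" using E X by (auto simp: iso_edge_sets_def)
    ultimately have "label_agreement_prob index_dist n (E \<union> X) = enn2real (\<Sum>m. emeasure index_dist {m} ^ n)"
      using \<open>0 < n\<close> by (intro label_agreement_prob_connected prob_space_index_dist) auto
    then show ?thesis using \<open>0 < n\<close> ps by (simp add: suminf_index_dist_power)
  qed
  then have "graph_density (edge_graph n E0) (graphon_to_seq a W)
      = (\<Sum>E\<in>iso_edge_sets n (edge_graph n E0). \<Sum>X\<in>Pow (vertex_pairs n - E).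
          power_sum a n * ((-1) ^ card X * hom_density n (E \<union> X) V))"
    unfolding graph_density_graphon_to_seq[OF V ae n] by (intro sum.cong refl) simp
  also have "\<dots> = power_sum a n * (\<Sum>E\<in>iso_edge_sets n (edge_graph n E0). induced_density n E V)"
    unfolding sum_distrib_left
    by (intro sum.cong refl) (simp add: V.induced_density_eq_hom_density sum_distrib_left iso_edge_sets_def)
  also have "\<dots> = power_sum a n * graph_density (edge_graph n E0) W"
    by (simp add: V.graph_density_eq[OF ae n])
  finally show ?thesis .
qed

lemma simple_graph_edge_graph: "E \<subseteq> vertex_pairs n \<Longrightarrow> simple_graph (edge_graph n E)"
proof -
  assume E: "E \<subseteq> vertex_pairs n"
  have "{i, j} \<subseteq> {..<n} \<and> card {i, j} = 2" if "(i, j) \<in> E" for i j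
    using that E by (auto simp: vertex_pairs_def card_insert_if)
  then show ?thesis by (auto simp: simple_graph_def edge_graph_def)
qed

lemma graph_iso_refl: "graph_iso G G"
  unfolding graph_iso_def by (rule exI[of _ id]) auto

definition star_pairs :: "nat \<Rightarrow> (nat \<times> nat) set" where
  "star_pairs n = {(0, j) | j. 0 < j \<and> j < n}"

lemma star_pairs_subset: "star_pairs n \<subseteq> vertex_pairs n"
  by (auto simp: star_pairs_def vertex_pairs_def)

lemma connected_star_pairs: "connected_pairs n (star_pairs n)"
  unfolding connected_pairs_def
proof (intro allI impI)
  fix x :: "nat \<Rightarrow> nat" and i j assume x: "\<forall>e\<in>star_pairs n. x (fst e) = x (snd e)" and "i < n" "j < n"
  have "x m = x 0" if "m < n" for m
  proof (cases "m = 0")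
    case False
    then have "(0, m) \<in> star_pairs n" using that by (simp add: star_pairs_def)
    then show ?thesis using x by force
  qed simp
  then show "x i = x j" using \<open>i < n\<close> \<open>j < n\<close> by metis
qed

text \<open>The star density is the moment of order \<open>n - 1\<close> of the degree function of
  \<open>V\<close>. A non-negative function with vanishing moment is 0 almost everywhere, and
  integrating the degree gives the integral of \<open>V\<close>.\<close>

lemma (in borel_kernel) AE_zero_of_hom_density_star:
  assumes hom: "hom_density n (star_pairs n) V = 0" and n: "2 \<le> n"
  shows "AE p in unit_lborel \<Otimes>\<^sub>M unit_lborel. V (fst p) (snd p) = 0"
proof -
  let ?P = unit_lborel
  have VP [measurable]: "(\<lambda>p. ennreal (V (fst p) (snd p))) \<in> borel_measurable (?P \<Otimes>\<^sub>M ?P)"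
    using V_borel by simp
  have Vy: "(\<lambda>z. ennreal (V y z)) \<in> borel_measurable ?P" if "y \<in> space ?P" for y
    using measurable_compose[OF measurable_Pair1'[OF that] VP] by simp
  have ins: "{..<n} = insert 0 {1..<n}" using n by auto
  let ?f = "\<lambda>x. \<Prod>j\<in>{1..<n}. ennreal (V (x 0) (x j))"
  have prod_eq: "ennreal (\<Prod>e\<in>star_pairs n. edge_weight V x e) = ?f x" for x
  proof -
    have "star_pairs n = Pair 0 ` {1..<n}" by (auto simp: star_pairs_def)
    then have "(\<Prod>e\<in>star_pairs n. edge_weight V x e) = (\<Prod>j\<in>{1..<n}. V (x 0) (x j))"
      by (simp add: prod.reindex inj_on_def edge_weight_def)
    then show ?thesis using V_range by (simp add: prod_ennreal)
  qed
  have "0 = ennreal (hom_density n (star_pairs n) V)" using hom by simp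
  also have "\<dots> = (\<integral>\<^sup>+x. ennreal (\<Prod>e\<in>star_pairs n. edge_weight V x e) \<partial>sample_points n)"
    unfolding hom_density_def
    by (intro nn_integral_eq_integral[symmetric] integrable_prod_edge_weight star_pairs_subset AE_I2
        prod_edge_weight_range)
  also have "\<dots> = (\<integral>\<^sup>+x. ?f x \<partial>PiM (insert 0 {1..<n}) (\<lambda>_. ?P))"
    by (simp add: prod_eq sample_points_eq ins)
  also have "\<dots> = (\<integral>\<^sup>+y. (\<integral>\<^sup>+x. ?f (x(0 := y)) \<partial>PiM {1..<n} (\<lambda>_. ?P)) \<partial>?P)"
  proof (rule unit_product.product_nn_integral_insert_rev)
    have "(\<lambda>x. ennreal (\<Prod>e\<in>star_pairs n. edge_weight V x e)) \<in> borel_measurable (sample_points n)"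
      using measurable_prod_edge_weight[OF star_pairs_subset] by simp
    then show "?f \<in> borel_measurable (PiM (insert 0 {1..<n}) (\<lambda>_. ?P))"
      by (simp add: prod_eq sample_points_eq ins)
  qed auto
  \<comment> \<open>Once the centre is fixed at \<open>y\<close>, the \<open>n - 1\<close> leaves
    are independent and each contributes the degree of \<open>y\<close>.\<close>
  also have "\<dots> = (\<integral>\<^sup>+y. (\<integral>\<^sup>+z. ennreal (V y z) \<partial>?P) ^ (n - 1) \<partial>?P)"
  proof (rule nn_integral_cong)
    fix y assume y: "y \<in> space ?P"
    have "(\<integral>\<^sup>+x. ?f (x(0 := y)) \<partial>PiM {1..<n} (\<lambda>_. ?P))
        = (\<integral>\<^sup>+x. (\<Prod>j\<in>{1..<n}. ennreal (V y (x j))) \<partial>PiM {1..<n} (\<lambda>_. ?P))"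
      by (intro nn_integral_cong prod.cong) auto
    also have "\<dots> = (\<Prod>j\<in>{1..<n}. \<integral>\<^sup>+z. ennreal (V y z) \<partial>?P)"
      using Vy[OF y] by (intro unit_product.product_nn_integral_prod) auto
    finally show "(\<integral>\<^sup>+x. ?f (x(0 := y)) \<partial>PiM {1..<n} (\<lambda>_. ?P)) = (\<integral>\<^sup>+z. ennreal (V y z) \<partial>?P) ^ (n - 1)"
      by simp
  qed
  finally have zero: "(\<integral>\<^sup>+y. (\<integral>\<^sup>+z. ennreal (V y z) \<partial>?P) ^ (n - 1) \<partial>?P) = 0" by simp
  have deg: "(\<lambda>y. \<integral>\<^sup>+z. ennreal (V y z) \<partial>?P) \<in> borel_measurable ?P"
    using unit_lborel.borel_measurable_nn_integral_fst[OF VP] by simp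
  then have "AE y in ?P. (\<integral>\<^sup>+z. ennreal (V y z) \<partial>?P) ^ (n - 1) = 0"
    using zero by (subst (asm) nn_integral_0_iff_AE) auto
  then have "AE y in ?P. (\<integral>\<^sup>+z. ennreal (V y z) \<partial>?P) = 0"
    by eventually_elim simp
  then have "(\<integral>\<^sup>+y. (\<integral>\<^sup>+z. ennreal (V y z) \<partial>?P) \<partial>?P) = 0"
    using deg by (subst nn_integral_0_iff_AE)
  then have "(\<integral>\<^sup>+p. ennreal (V (fst p) (snd p)) \<partial>(?P \<Otimes>\<^sub>M ?P)) = 0"
    using unit_lborel.nn_integral_fst[OF VP] by simp
  then have "AE p in ?P \<Otimes>\<^sub>M ?P. ennreal (V (fst p) (snd p)) = 0"
    by (subst (asm) nn_integral_0_iff_AE) auto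
  then show ?thesis
    using V_range by (auto elim!: eventually_mono simp: ennreal_eq_0_iff intro: antisym)
qed

section \<open>Perturbing the sequence and the conclusion\<close>

text \<open>The first \<open>n\<close> terms are replaced by the roots of the shifted polynomial and
  the tail is kept, so each power sum changes by the difference of two finite power sums.\<close>

lemma ex_partition_same_power_sums:
  assumes a: "unit_partition a" and inj: "inj a" and n: "2 \<le> n"
  obtains a' where "unit_partition a'"
    "\<forall>l\<in>{1..<n}. power_sum a' l = power_sum a l" "power_sum a' n \<noteq> power_sum a n"
proof -
  interpret unit_partition a by fact
  have "n \<noteq> 0" using n by simp
  have "inj_on a {..<n}" using inj by (rule inj_on_subset) simp
  obtain b c where c: "c \<noteq> 0" and b: "\<forall>i<n. 0 < b i" "root_poly n b = root_poly n a + [:c:]"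
    using ex_constant_shift_roots[OF \<open>n \<noteq> 0\<close> pos \<open>inj_on a {..<n}\<close>] .
  define a' where "a' = (\<lambda>i. if i < n then b i else a i)"
  have sums: "(\<lambda>i. a' i ^ l) sums (power_sum a l + ((\<Sum>i<n. b i ^ l) - (\<Sum>i<n. a i ^ l)))" if "1 \<le> l" for l
  proof -
    have "(\<lambda>i. a i ^ l) sums power_sum a l"
      unfolding power_sum_def using that by (intro summable_sums summable_power)
    moreover have "(\<lambda>i. a' i ^ l - a i ^ l) sums (\<Sum>i<n. a' i ^ l - a i ^ l)"
      by (intro sums_finite) (auto simp: a'_def)
    ultimately have "(\<lambda>i. a i ^ l + (a' i ^ l - a i ^ l)) sums (power_sum a l + (\<Sum>i<n. a' i ^ l - a i ^ l))"
      by (rule sums_add)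
    moreover have "(\<Sum>i<n. a' i ^ l - a i ^ l) = (\<Sum>i<n. b i ^ l) - (\<Sum>i<n. a i ^ l)"
      by (simp add: a'_def sum_subtractf)
    ultimately show ?thesis by simp
  qed
  have ps: "power_sum a' l = power_sum a l + ((\<Sum>i<n. b i ^ l) - (\<Sum>i<n. a i ^ l))" if "1 \<le> l" for l
    using sums[OF that] by (simp add: power_sum_def[of a'] sums_iff)
  have n0: "0 < n" using n by simp
  note shift = power_sums_of_constant_shift[OF b(2) n0]
  have same: "power_sum a' l = power_sum a l" if "1 \<le> l" "l < n" for l
    using ps[OF that(1)] shift(1)[OF that(2)] by simp
  \<comment> \<open>The total is the power sum of exponent 1, which is among the preserved ones
    because \<open>n\<close> is at least 2.\<close>
  have "power_sum a 1 = 1" using sums_1 by (simp add: power_sum_def sums_iff)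
  then have "a' sums 1" using sums[of 1] shift(1)[of 1] n by simp
  then have "unit_partition a'"
    by unfold_locales (use b(1) pos in \<open>auto simp: a'_def\<close>)
  moreover have "power_sum a' n \<noteq> power_sum a n"
    using ps[of n] shift(2) c n by simp
  ultimately show thesis using same by (intro that[of a']) auto
qed

lemma unit_partition_geometric:
  assumes "0 < \<alpha>" "\<alpha> < 1"
  shows "unit_partition (\<lambda>i. (1 - \<alpha>) * \<alpha> ^ i)"
proof
  show "(\<lambda>i. (1 - \<alpha>) * \<alpha> ^ i) sums 1"
    using sums_mult[OF geometric_sums[of \<alpha>], of "1 - \<alpha>"] assms by simp
qed (use assms in simp)

theorem theorem13:
  fixes \<alpha> :: real and W :: "real \<Rightarrow> real \<Rightarrow> real"
  assumes "0 < \<alpha>" and "\<alpha> < 1"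
    and "graphon W"
    and "finitely_forcible (graphon_to \<alpha> W)"
  shows "weakly_isomorphic W (\<lambda>_ _. 0) \<and>
    (AE (x, y) in lebesgue_on ({0..1} \<times> {0..1}). graphon_to \<alpha> W x y = 0)"
proof -
  define a where "a = (\<lambda>i. (1 - \<alpha>) * \<alpha> ^ i)"
  interpret a: unit_partition a unfolding a_def by (rule unit_partition_geometric) fact+
  have Wa: "graphon_to \<alpha> W = graphon_to_seq a W" by (simp add: graphon_to_def a_def)
  \<comment> \<open>Distinct terms make the first \<open>n\<close> of them simple roots, as the
    perturbation requires.\<close>
  have "inj a"
    using assms(1,2) by (auto simp: inj_on_def a_def power_inject_exp')
  obtain V where V: "borel_kernel V"
    and ae: "AE p in unit_lborel \<Otimes>\<^sub>M unit_lborel. W (fst p) (snd p) = V (fst p) (snd p)"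
    using graphon_ex_borel_kernel[OF \<open>graphon W\<close>] .
  interpret V: borel_kernel V by fact
  obtain \<H> where \<H>: "finite \<H>" and forces: "\<And>W'. graphon W' \<Longrightarrow>
      (\<And>H. H \<in> \<H> \<Longrightarrow> graph_density H W' = graph_density H (graphon_to_seq a W)) \<Longrightarrow>
      weakly_isomorphic W' (graphon_to_seq a W)"
    using assms(4) unfolding finitely_forcible_def Wa by metis
  \<comment> \<open>One more than every order in the forcing family; the inserted 1 ensures
    \<open>2 \<le> n\<close>.\<close>
  define n where "n = Max (insert 1 ((\<lambda>H. card (fst H)) ` \<H>)) + 1"
  have card_less: "card (fst H) < n" if "H \<in> \<H>" for H
    using that \<H> by (simp add: n_def less_Suc_eq_le)
  have n2: "2 \<le> n"
    using \<H> by (simp add: n_def)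
  obtain a' where a': "unit_partition a'"
    and same: "\<forall>l\<in>{1..<n}. power_sum a' l = power_sum a l"
    and diff: "power_sum a' n \<noteq> power_sum a n"
    using ex_partition_same_power_sums[OF a.unit_partition_axioms \<open>inj a\<close> n2] .
  interpret a': unit_partition a' by fact
  have iso: "weakly_isomorphic (graphon_to_seq a' W) (graphon_to_seq a W)"
  proof (rule forces)
    show "graphon (graphon_to_seq a' W)" by (rule a'.graphon_graphon_to_seq) fact
    fix H assume "H \<in> \<H>"
    then have "card (fst H) < n" by (rule card_less)
    then show "graph_density H (graphon_to_seq a' W) = graph_density H (graphon_to_seq a W)"
      using same
      by (intro graph_density_graphon_to_seq_cong a' a.unit_partition_axioms \<open>graphon W\<close>) auto
  qed
  \<comment> \<open>A graph with a spanning star is connected, so its densities in the two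
    indistinguishable graphons are its density in \<open>W\<close> times two different power sums.
    This density is 0, and so is each of its non-negative summands.\<close>
  have zero: "induced_density n E V = 0" if E: "E \<subseteq> vertex_pairs n" "star_pairs n \<subseteq> E" for E
  proof -
    let ?H = "edge_graph n E"
    have conn: "connected_pairs n E" using connected_star_pairs E(2) by (rule connected_pairs_mono)
    have "graph_density ?H (graphon_to_seq a' W) = graph_density ?H (graphon_to_seq a W)"
      using iso simple_graph_edge_graph[OF E(1)] unfolding weakly_isomorphic_def by blast
    then have "power_sum a' n * graph_density ?H W = power_sum a n * graph_density ?H W"
      using n2 by (simp add: a.graph_density_graphon_to_seq_connected[OF V ae E(1) conn]
          a'.graph_density_graphon_to_seq_connected[OF V ae E(1) conn])
    then have "graph_density ?H W = 0" using diff by simp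
    then have "(\<Sum>E'\<in>iso_edge_sets n ?H. induced_density n E' V) = 0"
      using V.graph_density_eq[OF ae, of n ?H] by (simp add: edge_graph_def)
    then have "\<forall>E'\<in>iso_edge_sets n ?H. induced_density n E' V = 0"
      by (simp add: sum_nonneg_eq_0_iff V.induced_density_nonneg)
    moreover have "E \<in> iso_edge_sets n ?H"
      using E(1) by (simp add: iso_edge_sets_def graph_iso_refl)
    ultimately show ?thesis by blast
  qed
  \<comment> \<open>The star density sums the induced densities of all edge sets containing the
    star, and these are 0.\<close>
  have "hom_density n (star_pairs n) V = 0"
    unfolding V.hom_density_eq_induced_density[OF star_pairs_subset]
    using star_pairs_subset[of n] by (intro sum.neutral ballI zero) auto
  then have V0: "AE p in unit_lborel \<Otimes>\<^sub>M unit_lborel. V (fst p) (snd p) = 0"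
    using n2 by (rule V.AE_zero_of_hom_density_star)
  with ae have W0: "AE p in unit_lborel \<Otimes>\<^sub>M unit_lborel. W (fst p) (snd p) = 0"
    by eventually_elim simp
  \<comment> \<open>The zero function is a Borel representative of \<open>W\<close> as well as of
    the zero graphon, so \<open>graph_density_eq\<close> gives both the same densities.\<close>
  interpret Z: borel_kernel "\<lambda>_ _. 0" by unfold_locales auto
  have "weakly_isomorphic W (\<lambda>_ _. 0)"
    unfolding weakly_isomorphic_def
    using Z.graph_density_eq[OF W0 refl] Z.graph_density_eq[of "\<lambda>_ _. 0", OF AE_I2 refl] by simp
  moreover have "AE p in lebesgue_on ({0..1} \<times> {0..1}). graphon_to_seq a W (fst p) (snd p) = 0"
    unfolding AE_lebesgue_on_unit_square_iff
    using a.AE_graphon_to_seq[of W "\<lambda>_ _. 0"] W0 by (simp add: a.cell_kernel_def)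
  ultimately show ?thesis by (simp add: Wa case_prod_unfold)
qed

end
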